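(* Suppose $p>0$ and $n+1+\alpha>0$. Then there exists a constant $C>0$ (depending on $p$ and $\alpha$) such that $$|f(z)|\le\frac{C\|f\|_{p,\alpha}}{(1-|z|^2)^{(n+1+\alpha)/p}}$$ for all $f\in A^p_\alpha$ and $z\in\mathbb B_n$.
   Context: Fix a positive integer $n$; $\alpha$ is real. $\mathbb B_n$ is the open unit ball of $\mathbb C^n$, $dv$ is volume measure, and $dv_\alpha(z)=(1-|z|^2)^\alpha dv(z)$ for real $\alpha$ (normalized to be a probability measure when $\alpha>-1$). The radial derivative is $Rf(z)=\sum_{k=1}^n z_k\frac{\partial f}{\partial z_k}(z)$, $R^k$ is its $k$-fold iterate, $R^0f=f$. For $p>0$ and real $\alpha$, $A^p_\alpha$ is the space of holomorphic $f$ in $\mathbb B_n$ such that, for a nonnegative integer $k$ with $pk+\alpha>-1$, $(1-|z|^2)^kR^kf(z)\in L^p(\mathbb B_n,dv_\alpha)$ (independent of the choice of such $k$). With $N$ the smallest nonnegative integer such that $pN+\alpha>-1$, $$\|f\|_{p,\alpha}=|f(0)|+\left[\int_{\mathbb B_n}(1-|z|^2)^{pN}|R^Nf(z)|^p\,dv_\alpha(z)\right]^{1/p}.$$ *)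

theory Defs
  imports "HOL-Analysis.Analysis"
begin

text \<open>
  The dimension is \<open>n = CARD('n)\<close>; the norm on \<^typ>\<open>complex ^ 'n\<close> is the Euclidean norm
  \<open>sqrt (\<Sum>k. (cmod (z $ k))\<^sup>2)\<close>, so the open unit ball is \<open>ball 0 1\<close>.  Functions are total; their
  values outside the ball play no role.
\<close>

definition cn_holomorphic_on :: "(complex ^ 'n \<Rightarrow> complex) \<Rightarrow> (complex ^ 'n) set \<Rightarrow> bool"
  where "cn_holomorphic_on f S \<longleftrightarrow>
    (\<forall>z\<in>S. \<exists>D. (f has_derivative D) (at z within S) \<and> (\<forall>c v. D (c *s v) = c * D v))"

definition partial_deriv :: "'n \<Rightarrow> (complex ^ 'n \<Rightarrow> complex) \<Rightarrow> complex ^ 'n \<Rightarrow> complex"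
  where "partial_deriv k f z = deriv (\<lambda>w. f (\<chi> j. if j = k then w else z $ j)) (z $ k)"

definition radial_deriv :: "(complex ^ 'n \<Rightarrow> complex) \<Rightarrow> complex ^ 'n \<Rightarrow> complex"
  where "radial_deriv f z = (\<Sum>k\<in>UNIV. z $ k * partial_deriv k f z)"

definition unnormalized_vol :: "real \<Rightarrow> (complex ^ 'n) measure"
  where "unnormalized_vol \<alpha> =
    density (restrict_space lborel (ball 0 1)) (\<lambda>z. ennreal ((1 - (norm z)\<^sup>2) powr \<alpha>))"

text \<open>The total mass of \<^const>\<open>unnormalized_vol\<close> is finite exactly for \<open>\<alpha> > -1\<close>.\<close>

definition weighted_vol :: "real \<Rightarrow> (complex ^ 'n) measure"
  where "weighted_vol \<alpha> =
    (if \<alpha> > -1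
     then scale_measure (inverse (emeasure (unnormalized_vol \<alpha> :: (complex ^ 'n) measure) (ball 0 1)))
            (unnormalized_vol \<alpha>)
     else unnormalized_vol \<alpha>)"

definition in_Lp :: "real \<Rightarrow> 'a measure \<Rightarrow> ('a \<Rightarrow> complex) \<Rightarrow> bool"
  where "in_Lp p M g \<longleftrightarrow>
    g \<in> borel_measurable M \<and> (\<integral>\<^sup>+ z. ennreal (cmod (g z) powr p) \<partial>M) < \<infinity>"

definition bergman_space :: "real \<Rightarrow> real \<Rightarrow> (complex ^ 'n \<Rightarrow> complex) set"
  where "bergman_space p \<alpha> = {f. cn_holomorphic_on f (ball 0 1) \<and>
    (\<exists>k::nat. p * real k + \<alpha> > -1 \<and>
      in_Lp p (weighted_vol \<alpha>)
        (\<lambda>z. complex_of_real ((1 - (norm z)\<^sup>2) ^ k) * (radial_deriv ^^ k) f z))}"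

definition bergman_order :: "real \<Rightarrow> real \<Rightarrow> nat"
  where "bergman_order p \<alpha> = (LEAST k::nat. p * real k + \<alpha> > -1)"

text \<open>Powers of extended nonnegative reals, for positive exponents.\<close>

definition ennreal_powr :: "ennreal \<Rightarrow> real \<Rightarrow> ennreal"
  where "ennreal_powr x a = (if x = \<infinity> then \<infinity> else ennreal (enn2real x powr a))"

text \<open>
  The norm takes values in \<open>[0, \<infinity>]\<close>, so that a divergent integral gives \<open>\<infinity>\<close> and not the default
  value \<open>0\<close> of the Bochner integral.
\<close>

definition bergman_norm :: "real \<Rightarrow> real \<Rightarrow> (complex ^ 'n \<Rightarrow> complex) \<Rightarrow> ennreal"
  where "bergman_norm p \<alpha> f = (let N = bergman_order p \<alpha> in
    ennreal (cmod (f 0)) +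
    ennreal_powr
      (\<integral>\<^sup>+ z. ennreal ((1 - (norm z)\<^sup>2) powr (p * real N) * cmod ((radial_deriv ^^ N) f z) powr p)
         \<partial>weighted_vol \<alpha>)
      (1 / p))"

end

theory Submission
  imports Defs "HOL-Complex_Analysis.Complex_Analysis"
begin

text \<open>
  Write \<open>\<delta>(z) = 1 - |z|\<^sup>2\<close>, \<open>b = (n + 1 + \<alpha>) / p > 0\<close>, \<open>g = R\<^sup>N f\<close> and \<open>\<gamma> = \<alpha> + p N\<close>, so
  that the integral in the norm is comparable to \<open>\<integral> \<delta>\<^sup>\<gamma> |g|\<^sup>p dv\<close>.  The estimate has two halves.

  \<^emph>\<open>The weighted pointwise bound\<close> \<open>|g(z)|\<^sup>p \<delta>(z)\<^bsup>n+1+\<gamma>\<^esup> \<le> C \<integral> \<delta>\<^sup>\<gamma> |g|\<^sup>p dv\<close>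
  (\<open>weighted_pointwise_bound\<close>).  Since \<open>|g|\<^sup>p\<close> has the sub-mean value property on every complex line
  through \<open>z\<close>, averaging over the lines yields
  \<open>|g(z)|\<^sup>p vol(E) \<le> \<integral>\<^sub>E |g(z + w)|\<^sup>p dw\<close> for each set \<open>E\<close> that is invariant under multiplication
  by unimodular scalars, as long as the discs spanned by \<open>z + E\<close> stay in the domain
  (\<open>submean_circular\<close>).  A Euclidean ball of radius comparable to \<open>\<delta>(z)\<close>
  would give only the exponent \<open>2n\<close>.  The right \<open>E\<close> is non-isotropic: its extent is of order \<open>\<delta>(z)\<close> in
  the complex direction of \<open>z\<close> and \<open>\<surd>\<delta>(z)\<close> in the complex directions orthogonal to \<open>z\<close>.  On \<open>z + E\<close> the
  function \<open>\<delta>\<close> is still comparable to \<open>\<delta>(z)\<close> (\<open>slab_translate_defect\<close>), and \<open>vol(E)\<close> is at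
  least a constant times \<open>\<delta>(z)\<^bsup>n+1\<^esup>\<close> (\<open>emeasure_slab_ge\<close>).

  \<^emph>\<open>Radial integration\<close> (\<open>radial_growth_integration\<close>).  If \<open>Ru = O(\<delta>\<^bsup>-(c+1)\<^esup>)\<close> with \<open>c > 0\<close>, then
  \<open>u - u(0) = O(\<delta>\<^bsup>-c\<^esup>)\<close>, because \<open>t \<cdot> d/dt u(tz) = (Ru)(tz)\<close>.  The first
  half gives \<open>R\<^sup>N f = O(\<delta>\<^bsup>-(b+N)\<^esup>)\<close>, as \<open>(n + 1 + \<gamma>) / p = b + N\<close>, and integrating \<open>N\<close> times yields \<open>f - f(0) = O(\<delta>\<^bsup>-b\<^esup>)\<close>; the values
  \<open>R\<^sup>k f(0)\<close> with \<open>k \<ge> 1\<close> vanish, so only \<open>f(0)\<close> remains as a constant of integration.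

  For \<open>p < 1\<close> the sub-mean value inequality on circles is the subtle ingredient.  It is proved
  without reference to zeros: \<open>log(|h|\<^sup>p + \<epsilon>)\<close> is approximated on the unit circle by \<open>Re k\<close> with \<open>k\<close>
  entire, and the maximum principle for \<open>h e\<^bsup>-k/p\<^esup>\<close> is combined with the mean value property of
  \<open>e\<^sup>k\<close> (\<open>circle_submean_powr\<close>).
\<close>

section \<open>Sub-mean value inequality for powers of the modulus on a circle\<close>

text \<open>
  Real trigonometric polynomials, as real parts of polynomials, up to equality on the unit circle.
  The last rule makes the class closed under products: on the circle \<open>cnj \<zeta> = 1 / \<zeta>\<close>, so that mixed
  monomials reduce to pure ones.
\<close>

inductive trig_poly :: "(complex \<Rightarrow> real) \<Rightarrow> bool" where
  monomial: "trig_poly (\<lambda>\<zeta>. Re (c * \<zeta> ^ n))"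
| add: "trig_poly f \<Longrightarrow> trig_poly g \<Longrightarrow> trig_poly (\<lambda>\<zeta>. f \<zeta> + g \<zeta>)"
| on_circle: "trig_poly f \<Longrightarrow> (\<And>\<zeta>. \<zeta> \<in> sphere 0 1 \<Longrightarrow> g \<zeta> = f \<zeta>) \<Longrightarrow> trig_poly g"

lemma trig_poly_const: "trig_poly (\<lambda>\<zeta>. a)"
  using trig_poly.monomial[of "of_real a" 0] by simp

lemma trig_poly_continuous_on: "trig_poly f \<Longrightarrow> continuous_on (sphere 0 1) f"
proof (induction rule: trig_poly.induct)
  case (on_circle f g)
  then show ?case by (metis continuous_on_cong)
qed (auto intro!: continuous_intros)

lemma trig_poly_eq_Re_entire:
  "trig_poly f \<Longrightarrow> \<exists>k. k holomorphic_on UNIV \<and> (\<forall>\<zeta>\<in>sphere 0 1. f \<zeta> = Re (k \<zeta>))"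
proof (induction rule: trig_poly.induct)
  case (monomial c n)
  show ?case by (rule exI[of _ "\<lambda>\<zeta>. c * \<zeta> ^ n"]) (auto intro!: holomorphic_intros)
next
  case (add f g)
  then obtain k l where "k holomorphic_on UNIV" "\<forall>\<zeta>\<in>sphere 0 1. f \<zeta> = Re (k \<zeta>)"
      "l holomorphic_on UNIV" "\<forall>\<zeta>\<in>sphere 0 1. g \<zeta> = Re (l \<zeta>)" by blast
  then show ?case
    by (intro exI[of _ "\<lambda>\<zeta>. k \<zeta> + l \<zeta>"]) (auto intro!: holomorphic_intros)
qed auto

text \<open>
  From \<open>2 Re x Re y = Re (x y) + Re (x cnj y)\<close>.
\<close>

lemma trig_poly_mult_monomials:
  "trig_poly (\<lambda>\<zeta>. Re (c * \<zeta> ^ n) * Re (d * \<zeta> ^ m))"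
proof -
  have main: "trig_poly (\<lambda>\<zeta>. Re (c * \<zeta> ^ n) * Re (d * \<zeta> ^ m))" if "m \<le> n" for c d n m
  proof (rule trig_poly.on_circle)
    show "trig_poly (\<lambda>\<zeta>. Re (c * d / 2 * \<zeta> ^ (n + m)) + Re (c * cnj d / 2 * \<zeta> ^ (n - m)))"
      by (intro trig_poly.intros)
  next
    fix \<zeta> :: complex assume "\<zeta> \<in> sphere 0 1"
    then have "\<zeta> * cnj \<zeta> = 1"
      by (simp add: complex_norm_square[symmetric])
    then have "\<zeta> ^ m * cnj (\<zeta> ^ m) = 1"
      by (metis complex_cnj_power power_mult_distrib power_one)
    then have "\<zeta> ^ n * cnj (\<zeta> ^ m) = \<zeta> ^ (n - m)"
      using that by (metis (no_types, opaque_lifting) le_add_diff_inverse2 mult.assoc mult.right_neutral power_add)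
    then have "c * \<zeta> ^ n * cnj (d * \<zeta> ^ m) / 2 = c * cnj d / 2 * \<zeta> ^ (n - m)"
      by (simp add: mult.assoc mult.left_commute)
    moreover have "c * \<zeta> ^ n * (d * \<zeta> ^ m) / 2 = c * d / 2 * \<zeta> ^ (n + m)"
      by (simp add: power_add)
    moreover have "Re x * Re y = Re (x * y / 2) + Re (x * cnj y / 2)" for x y
      by (simp add: field_simps)
    ultimately show "Re (c * \<zeta> ^ n) * Re (d * \<zeta> ^ m) =
        Re (c * d / 2 * \<zeta> ^ (n + m)) + Re (c * cnj d / 2 * \<zeta> ^ (n - m))"
      by metis
  qed
  show ?thesis
    using main[of m n c d] main[of n m d c] by (cases "m \<le> n") (auto simp: mult.commute)
qed

lemma trig_poly_mult:
  assumes "trig_poly f" "trig_poly g"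
  shows "trig_poly (\<lambda>\<zeta>. f \<zeta> * g \<zeta>)"
  using assms(1)
proof (induction rule: trig_poly.induct)
  case (monomial c n)
  show ?case using assms(2)
  proof (induction rule: trig_poly.induct)
    case (monomial d m)
    show ?case by (rule trig_poly_mult_monomials)
  next
    case (add f g)
    then show ?case by (simp only: distrib_left trig_poly.add)
  next
    case (on_circle f g)
    then show ?case by (metis (no_types, lifting) trig_poly.on_circle)
  qed
next
  case (add f g)
  then show ?case by (simp only: distrib_right trig_poly.add)
next
  case (on_circle f h)
  then show ?case by (metis (no_types, lifting) trig_poly.on_circle)
qed

text \<open>
  Stone-Weierstrass: trigonometric polynomials form an algebra, and \<open>Re\<close>, \<open>Im\<close> separate points.
\<close>

lemma continuous_on_circle_approx_Re_entire:
  fixes \<phi> :: "complex \<Rightarrow> real"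
  assumes "continuous_on (sphere 0 1) \<phi>" and "\<epsilon> > 0"
  obtains k where "k holomorphic_on UNIV"
    and "\<And>\<zeta>. \<zeta> \<in> sphere 0 1 \<Longrightarrow> \<bar>\<phi> \<zeta> - Re (k \<zeta>)\<bar> < \<epsilon>"
proof -
  have "\<exists>g. trig_poly g \<and> (\<forall>\<zeta>\<in>sphere 0 1. \<bar>\<phi> \<zeta> - g \<zeta>\<bar> < \<epsilon>)"
  proof (rule Stone_Weierstrass_HOL)
    fix x y :: complex assume "x \<in> sphere 0 1 \<and> y \<in> sphere 0 1 \<and> x \<noteq> y"
    then have "Re x \<noteq> Re y \<or> Re (- \<i> * x) \<noteq> Re (- \<i> * y)"
      by (auto simp: complex_eq_iff)
    then show "\<exists>f. trig_poly f \<and> f x \<noteq> f y"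
      using trig_poly.monomial[of 1 1] trig_poly.monomial[of "- \<i>" 1]
      by (metis (no_types, lifting) mult_1 power_one_right)
  qed (use assms in \<open>auto intro: trig_poly_const trig_poly_continuous_on trig_poly.add trig_poly_mult\<close>)
  then obtain g where "trig_poly g" "\<forall>\<zeta>\<in>sphere 0 1. \<bar>\<phi> \<zeta> - g \<zeta>\<bar> < \<epsilon>" by blast
  with trig_poly_eq_Re_entire[OF this(1)] that show thesis by metis
qed

lemma has_integral_circle_mean:
  assumes "continuous_on (cball 0 1) h" "h holomorphic_on ball 0 1"
  shows "((\<lambda>t. h (cis (2 * pi * t))) has_integral h 0) {0..1}"
proof -
  have "((\<lambda>u. h u / (u - 0)) has_contour_integral (2 * of_real pi * \<i> * h 0)) (circlepath 0 1)"
    by (rule Cauchy_integral_circlepath) (use assms in auto)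
  then have "((\<lambda>t. h (cis (2 * pi * t)) / cis (2 * pi * t) * (2 * pi * \<i> * cis (2 * pi * t)))
      has_integral 2 * of_real pi * \<i> * h 0) {0..1}"
    unfolding has_contour_integral vector_derivative_circlepath
    by (simp add: circlepath cis_conv_exp mult_ac)
  then have "((\<lambda>t. 2 * of_real pi * \<i> * h (cis (2 * pi * t)))
      has_integral 2 * of_real pi * \<i> * h 0) {0..1}"
    by (simp add: mult_ac)
  from has_integral_mult_right[OF this, of "inverse (2 * of_real pi * \<i>)"]
  show ?thesis by (simp add: field_simps)
qed

text \<open>
  Let \<open>\<phi> = log(|h|\<^sup>p + \<epsilon>)\<close> and let \<open>k\<close> be entire with \<open>|\<phi> - Re k| < \<epsilon>\<close> on the circle.  There
  \<open>|h|\<^sup>p \<le> e\<^sup>\<phi> \<le> e\<^bsup>\<epsilon> + Re k\<^esup>\<close>, so the maximum principle for \<open>h e\<^bsup>-k/p\<^esup>\<close> gives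
  \<open>|h(0)|\<^sup>p \<le> e\<^sup>\<epsilon> |e\<^bsup>k(0)\<^esup>|\<close>.  The mean value property of \<open>e\<^sup>k\<close> bounds \<open>|e\<^bsup>k(0)\<^esup>|\<close> by the mean of
  \<open>e\<^bsup>Re k\<^esup> \<le> e\<^sup>\<epsilon> (|h|\<^sup>p + \<epsilon>)\<close>.  Now let \<open>\<epsilon> \<rightarrow> 0\<close>.
\<close>

lemma circle_submean_powr:
  assumes cont: "continuous_on (cball 0 1) h" and hol: "h holomorphic_on ball 0 1" and "p > 0"
  shows "cmod (h 0) powr p \<le> integral {0..1} (\<lambda>t. cmod (h (cis (2 * pi * t))) powr p)"
proof -
  define I where "I = integral {0..1} (\<lambda>t. cmod (h (cis (2 * pi * t))) powr p)"
  have cont_h: "continuous_on {0..1} (\<lambda>t. h (cis (2 * pi * t)))"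
    by (rule continuous_on_compose2[OF cont]) (auto intro!: continuous_intros)
  have int_h: "(\<lambda>t. cmod (h (cis (2 * pi * t))) powr p) integrable_on {0..1}"
    by (rule integrable_continuous_real) (use cont_h \<open>p > 0\<close> in \<open>auto intro!: continuous_intros continuous_on_powr'\<close>)
  have bound: "cmod (h 0) powr p \<le> exp (2 * \<epsilon>) * (I + \<epsilon>)" if "\<epsilon> > 0" for \<epsilon>
  proof -
    define \<phi> where "\<phi> \<zeta> = ln (cmod (h \<zeta>) powr p + \<epsilon>)" for \<zeta>
    have pos: "cmod (h \<zeta>) powr p + \<epsilon> > 0" for \<zeta>
      using that by (simp add: add_nonneg_pos)
    have "continuous_on (sphere 0 1) h"
      by (rule continuous_on_subset[OF cont]) auto
    then have "continuous_on (sphere 0 1) \<phi>"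
      unfolding \<phi>_def using \<open>p > 0\<close> pos
      by (auto intro!: continuous_intros continuous_on_powr' simp: less_imp_neq[symmetric])
    then obtain k where k: "k holomorphic_on UNIV"
      and approx: "\<And>\<zeta>. \<zeta> \<in> sphere 0 1 \<Longrightarrow> \<bar>\<phi> \<zeta> - Re (k \<zeta>)\<bar> < \<epsilon>"
      using continuous_on_circle_approx_Re_entire \<open>\<epsilon> > 0\<close> by blast
    have contk: "continuous_on S k" for S
      using k holomorphic_on_imp_continuous_on holomorphic_on_subset by blast
    have holk: "k holomorphic_on S" for S
      using k holomorphic_on_subset by blast
    let ?q = "\<lambda>\<zeta>. h \<zeta> * exp (- k \<zeta> / of_real p)"
    have "cmod (?q 0) \<le> exp (\<epsilon> / p)"
    proof (rule maximum_modulus_frontier[of ?q "cball 0 1"])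
      show "?q holomorphic_on interior (cball 0 1)"
        using hol holk \<open>p > 0\<close> by (auto intro!: holomorphic_intros)
      show "continuous_on (closure (cball 0 1)) ?q"
        using cont contk \<open>p > 0\<close> by (auto intro!: continuous_intros)
      fix \<zeta> :: complex assume "\<zeta> \<in> frontier (cball 0 1)"
      then have \<zeta>: "\<zeta> \<in> sphere 0 1" by simp
      show "cmod (?q \<zeta>) \<le> exp (\<epsilon> / p)"
      proof (cases "h \<zeta> = 0")
        case False
        have "cmod (h \<zeta>) powr p \<le> exp (\<phi> \<zeta>)"
          using pos[of \<zeta>] that by (simp add: \<phi>_def)
        also have "\<dots> \<le> exp (Re (k \<zeta>) + \<epsilon>)"
          using approx[OF \<zeta>] by simp
        finally have "p * ln (cmod (h \<zeta>)) \<le> Re (k \<zeta>) + \<epsilon>"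
          using False by (simp add: powr_def)
        then have "ln (cmod (h \<zeta>)) \<le> (Re (k \<zeta>) + \<epsilon>) / p"
          using \<open>p > 0\<close> by (simp add: field_simps)
        then have "cmod (h \<zeta>) \<le> exp ((Re (k \<zeta>) + \<epsilon>) / p)"
          using False by (metis exp_le_cancel_iff exp_ln zero_less_norm_iff)
        then show ?thesis
          by (simp add: norm_mult norm_divide exp_minus add_divide_distrib exp_add field_simps)
      qed simp
    qed auto
    then have "cmod (h 0) \<le> exp ((Re (k 0) + \<epsilon>) / p)"
      by (simp add: norm_mult norm_divide exp_minus add_divide_distrib exp_add field_simps)
    then have "cmod (h 0) powr p \<le> exp ((Re (k 0) + \<epsilon>) / p) powr p"
      using \<open>p > 0\<close> by (intro powr_mono2) auto
    also have "\<dots> = exp \<epsilon> * exp (Re (k 0))"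
      using \<open>p > 0\<close> by (simp add: powr_def exp_add)
    also have "exp (Re (k 0)) \<le> exp \<epsilon> * (I + \<epsilon>)"
    proof -
      have mean: "((\<lambda>t. exp (k (cis (2 * pi * t)))) has_integral exp (k 0)) {0..1}"
        by (rule has_integral_circle_mean) (auto intro!: continuous_intros holomorphic_intros contk holk)
      have int_g: "(\<lambda>t. exp \<epsilon> * (cmod (h (cis (2 * pi * t))) powr p + \<epsilon>)) integrable_on {0..1}"
        by (rule integrable_continuous_real) (use cont_h \<open>p > 0\<close> in \<open>auto intro!: continuous_intros continuous_on_powr'\<close>)
      have "exp (Re (k 0)) = cmod (integral {0..1} (\<lambda>t. exp (k (cis (2 * pi * t)))))"
        using mean by (simp add: integral_unique)
      also have "\<dots> \<le> integral {0..1} (\<lambda>t. exp \<epsilon> * (cmod (h (cis (2 * pi * t))) powr p + \<epsilon>))"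
      proof (rule integral_norm_bound_integral)
        fix t :: real
        have "Re (k (cis (2 * pi * t))) \<le> \<epsilon> + \<phi> (cis (2 * pi * t))"
          using approx[of "cis (2 * pi * t)"] by simp
        then have "exp (Re (k (cis (2 * pi * t)))) \<le> exp (\<epsilon> + \<phi> (cis (2 * pi * t)))"
          by simp
        also have "\<dots> = exp \<epsilon> * (cmod (h (cis (2 * pi * t))) powr p + \<epsilon>)"
          using pos by (simp add: \<phi>_def exp_add)
        finally show "cmod (exp (k (cis (2 * pi * t)))) \<le> exp \<epsilon> * (cmod (h (cis (2 * pi * t))) powr p + \<epsilon>)"
          by simp
      qed (use mean int_g in \<open>auto simp: integrable_on_def\<close>)
      also have "\<dots> = exp \<epsilon> * (I + \<epsilon>)"
        using integral_add[OF int_h integrable_continuous_real, of "\<lambda>_. \<epsilon>"] by (simp add: I_def)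
      finally show ?thesis .
    qed
    finally show ?thesis
      by (simp add: exp_add[symmetric] mult.assoc[symmetric])
  qed
  have "((\<lambda>\<epsilon>. exp (2 * \<epsilon>) * (I + \<epsilon>)) \<longlongrightarrow> exp (2 * 0) * (I + 0)) (at_right 0)"
    by (intro tendsto_intros)
  then have "cmod (h 0) powr p \<le> exp (2 * 0) * (I + 0)"
    by (rule tendsto_lowerbound) (auto simp: eventually_at_right_less bound intro: eventually_at_rightI[of 0 1])
  then show ?thesis by (simp add: I_def)
qed

section \<open>Holomorphic functions of several variables\<close>

lemma norm_complex_smult: "norm (c *s v) = cmod c * norm v" for v :: "complex ^ 'n"
  unfolding norm_vec_def by (simp add: norm_mult L2_set_right_distrib)

lemma bounded_bilinear_complex_smult: "bounded_bilinear ((*s) :: complex \<Rightarrow> complex ^ 'n \<Rightarrow> complex ^ 'n)"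
  by (rule bounded_bilinear.intro)
     (auto simp: vec_eq_iff algebra_simps norm_complex_smult intro!: exI[of _ 1])

lemmas continuous_on_complex_smult [continuous_intros] =
  bounded_bilinear.continuous_on[OF bounded_bilinear_complex_smult]

lemma frechet_derivative_holomorphic:
  assumes "cn_holomorphic_on f S" "open S" "z \<in> S"
  shows "(f has_derivative frechet_derivative f (at z)) (at z)"
    and "frechet_derivative f (at z) (c *s v) = c * frechet_derivative f (at z) v"
proof -
  obtain D where D: "(f has_derivative D) (at z)" and lin: "\<And>c v. D (c *s v) = c * D v"
    using assms unfolding cn_holomorphic_on_def by (metis at_within_open)
  have "frechet_derivative f (at z) = D"
    using frechet_derivative_at[OF D] by simp
  with D lin show "(f has_derivative frechet_derivative f (at z)) (at z)"
    "frechet_derivative f (at z) (c *s v) = c * frechet_derivative f (at z) v"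
    by auto
qed

lemma cn_holomorphic_on_imp_continuous_on: "cn_holomorphic_on f S \<Longrightarrow> continuous_on S f"
  unfolding cn_holomorphic_on_def continuous_on_eq_continuous_within
  using has_derivative_continuous by blast

lemma cn_holomorphic_on_cong:
  assumes "cn_holomorphic_on f S" "\<And>z. z \<in> S \<Longrightarrow> g z = f z"
  shows "cn_holomorphic_on g S"
  using assms unfolding cn_holomorphic_on_def by (metis has_derivative_transform)

lemma cn_holomorphic_on_component: "cn_holomorphic_on (\<lambda>z. z $ k) S"
  unfolding cn_holomorphic_on_def
  by (auto intro!: exI[of _ "\<lambda>z. z $ k"] bounded_linear_imp_has_derivative bounded_linear_vec_nth)

lemma cn_holomorphic_on_mult:
  assumes "cn_holomorphic_on f S" "cn_holomorphic_on g S"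
  shows "cn_holomorphic_on (\<lambda>z. f z * g z) S"
  unfolding cn_holomorphic_on_def
proof
  fix z assume "z \<in> S"
  then obtain D E where "(f has_derivative D) (at z within S)" "\<forall>c v. D (c *s v) = c * D v"
      "(g has_derivative E) (at z within S)" "\<forall>c v. E (c *s v) = c * E v"
    using assms unfolding cn_holomorphic_on_def by metis
  then show "\<exists>D. ((\<lambda>z. f z * g z) has_derivative D) (at z within S) \<and> (\<forall>c v. D (c *s v) = c * D v)"
    by (intro exI[of _ "\<lambda>h. f z * E h + D h * g z"] conjI has_derivative_mult)
       (simp_all add: algebra_simps)
qed

lemma cn_holomorphic_on_sum:
  assumes "\<And>i. i \<in> I \<Longrightarrow> cn_holomorphic_on (f i) S"
  shows "cn_holomorphic_on (\<lambda>z. \<Sum>i\<in>I. f i z) S"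
  unfolding cn_holomorphic_on_def
proof
  fix z assume "z \<in> S"
  with assms have "\<forall>i\<in>I. \<exists>D. (f i has_derivative D) (at z within S) \<and> (\<forall>c v. D (c *s v) = c * D v)"
    unfolding cn_holomorphic_on_def by simp
  from bchoice[OF this] obtain D where "\<forall>i\<in>I. (f i has_derivative D i) (at z within S) \<and>
      (\<forall>c v. D i (c *s v) = c * D i v)" by blast
  then show "\<exists>D. ((\<lambda>z. \<Sum>i\<in>I. f i z) has_derivative D) (at z within S) \<and> (\<forall>c v. D (c *s v) = c * D v)"
    by (intro exI[of _ "\<lambda>h. \<Sum>i\<in>I. D i h"])
       (auto intro!: has_derivative_sum simp: sum_distrib_left)
qed

text \<open>
  Restriction to complex lines is what lets one-variable theory act on functions of several variables.
\<close>

lemma has_field_derivative_along_line: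
  fixes z w :: "complex ^ 'n"
  assumes "cn_holomorphic_on f S" "open S" "z + \<zeta> *s w \<in> S"
  shows "((\<lambda>\<zeta>. f (z + \<zeta> *s w)) has_field_derivative frechet_derivative f (at (z + \<zeta> *s w)) w) (at \<zeta>)"
proof -
  let ?D = "frechet_derivative f (at (z + \<zeta> *s w))"
  note D = frechet_derivative_holomorphic[OF assms]
  have "((\<lambda>\<zeta>. z + \<zeta> *s w) has_derivative (\<lambda>\<zeta>. \<zeta> *s w)) (at \<zeta>)"
    by (auto intro!: derivative_eq_intros bounded_linear_imp_has_derivative
        bounded_bilinear.bounded_linear_left[OF bounded_bilinear_complex_smult])
  from has_derivative_compose[OF this D(1)]
  show ?thesis
    by (simp add: has_field_derivative_def D(2) mult.commute[of _ "?D w"] cong: if_cong)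
qed

lemma holomorphic_on_along_line:
  assumes "cn_holomorphic_on f S" "open S" "\<And>\<zeta>. \<zeta> \<in> U \<Longrightarrow> z + \<zeta> *s w \<in> S"
  shows "(\<lambda>\<zeta>. f (z + \<zeta> *s w)) holomorphic_on U"
  unfolding holomorphic_on_def field_differentiable_def
  using has_field_derivative_along_line[OF assms(1,2) assms(3)]
    has_field_derivative_at_within by blast

lemma partial_deriv_eq_frechet_derivative:
  fixes z :: "complex ^ 'n"
  assumes "cn_holomorphic_on f S" "open S" "z \<in> S"
  shows "partial_deriv k f z = frechet_derivative f (at z) (axis k 1)"
proof -
  have eq: "(\<chi> j. if j = k then w else z $ j) = (z - (z $ k) *s axis k 1) + w *s axis k 1" for w
    by (simp add: vec_eq_iff axis_def)
  show ?thesis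
    unfolding partial_deriv_def eq
    by (intro DERIV_imp_deriv)
       (use has_field_derivative_along_line[OF assms(1,2), of "z - (z $ k) *s axis k 1" "z $ k" "axis k 1"] assms(3)
         in simp)
qed

text \<open>
  Expand the second argument \<open>z\<close> in the standard basis and use complex linearity.  In this form the
  radial derivative is visibly the derivative along the line through \<open>0\<close> and \<open>z\<close>.
\<close>

lemma radial_deriv_eq_frechet_derivative:
  fixes z :: "complex ^ 'n"
  assumes "cn_holomorphic_on f S" "open S" "z \<in> S"
  shows "radial_deriv f z = frechet_derivative f (at z) z"
proof -
  note D = frechet_derivative_holomorphic[OF assms]
  have lin: "linear (frechet_derivative f (at z))"
    using D(1) has_derivative_linear by blast
  have "frechet_derivative f (at z) z = frechet_derivative f (at z) (\<Sum>k\<in>UNIV. z $ k *s axis k 1)"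
    by (simp add: basis_expansion)
  also have "\<dots> = radial_deriv f z"
    unfolding radial_deriv_def linear_sum[OF lin]
    by (simp add: D(2) partial_deriv_eq_frechet_derivative[OF assms])
  finally show ?thesis by simp
qed

lemma frechet_derivative_Cauchy:
  fixes z v :: "complex ^ 'n"
  assumes "cn_holomorphic_on f S" "open S" "0 < r" "\<And>\<zeta>. cmod \<zeta> \<le> r \<Longrightarrow> z + \<zeta> *s v \<in> S"
  shows "frechet_derivative f (at z) v =
    integral (cbox 0 1) (\<lambda>t. f (z + (r * cis (2 * pi * t)) *s v) * (cis (- (2 * pi * t)) / r))"
proof -
  let ?h = "\<lambda>\<zeta>. f (z + \<zeta> *s v)"
  have hol: "?h holomorphic_on cball 0 r"
    by (rule holomorphic_on_along_line[OF assms(1,2)]) (use assms(4) in auto)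
  have "(?h has_field_derivative (1 / (2 * of_real pi * \<i>) *
      contour_integral (circlepath 0 r) (\<lambda>u. ?h u / (u - 0)^2))) (at 0)"
    using assms(3) hol
    by (intro Cauchy_derivative_integral_circlepath)
       (auto intro: holomorphic_on_imp_continuous_on holomorphic_on_subset)
  moreover have "(?h has_field_derivative frechet_derivative f (at z) v) (at 0)"
    using has_field_derivative_along_line[OF assms(1,2), of z 0 v] assms(3) assms(4)[of 0] by simp
  ultimately have "frechet_derivative f (at z) v =
      1 / (2 * of_real pi * \<i>) * contour_integral (circlepath 0 r) (\<lambda>u. ?h u / (u - 0)^2)"
    using DERIV_unique by blast
  also have "contour_integral (circlepath 0 r) (\<lambda>u. ?h u / (u - 0)^2) = integral {0..1} (\<lambda>t.
      ?h (r * cis (2 * pi * t)) / (r * cis (2 * pi * t))^2 * (2 * pi * \<i> * r * cis (2 * pi * t)))"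
    unfolding contour_integral_integral vector_derivative_circlepath
    by (simp add: circlepath cis_conv_exp mult_ac)
  also have "1 / (2 * of_real pi * \<i>) * \<dots> = integral {0..1} (\<lambda>t. 1 / (2 * of_real pi * \<i>) *
      (?h (r * cis (2 * pi * t)) / (r * cis (2 * pi * t))^2 * (2 * pi * \<i> * r * cis (2 * pi * t))))"
    by (rule integral_mult_right[symmetric])
  also have "\<dots> = integral {0..1} (\<lambda>t. ?h (r * cis (2 * pi * t)) * (cis (- (2 * pi * t)) / r))"
    using assms(3)
    unfolding cis_inverse[symmetric]
    by (intro integral_cong) (simp add: field_simps power2_eq_square del: cis_inverse)
  finally show ?thesis by simp
qed

text \<open>
  One radius serves for all base points near \<open>z0\<close>, so that the Cauchy formula can be regarded as an
  integral depending on the parameter \<open>z\<close>.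
\<close>

lemma frechet_derivative_Cauchy_nearby:
  fixes z0 v :: "complex ^ 'n"
  assumes "cn_holomorphic_on f S" "open S" "z0 \<in> S"
  obtains \<rho> r where "0 < \<rho>" "0 < r" "ball z0 \<rho> \<subseteq> S"
    and "\<And>z \<zeta>. z \<in> ball z0 \<rho> \<Longrightarrow> cmod \<zeta> \<le> r \<Longrightarrow> z + \<zeta> *s v \<in> S"
    and "\<And>z. z \<in> ball z0 \<rho> \<Longrightarrow> frechet_derivative f (at z) v =
      integral (cbox 0 1) (\<lambda>t. f (z + (r * cis (2 * pi * t)) *s v) * (cis (- (2 * pi * t)) / r))"
proof -
  obtain e where e: "e > 0" "ball z0 e \<subseteq> S" using assms(2,3) open_contains_ball by blast
  define r where "r = e / 2 / (norm v + 1)"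
  have "norm v + 1 > 0" by (simp add: add_nonneg_pos)
  then have r: "r > 0" "r * norm v \<le> e / 2" using e by (auto simp: r_def field_simps)
  have inS: "z + \<zeta> *s v \<in> S" if "z \<in> ball z0 (e / 2)" "cmod \<zeta> \<le> r" for z \<zeta>
  proof -
    have "norm (\<zeta> *s v) \<le> e / 2"
      using mult_right_mono[OF that(2) norm_ge_zero[of v]] r(2) by (simp add: norm_complex_smult)
    then have "z + \<zeta> *s v \<in> ball z0 e"
      using that(1) norm_triangle_ineq4[of "z0 - z" "\<zeta> *s v"] by (simp add: dist_norm algebra_simps)
    then show ?thesis using e by auto
  qed
  show thesis
  proof (rule that[of "e / 2" r])
    show "ball z0 (e / 2) \<subseteq> S" using e subset_ball[of "e / 2" e z0] by simp
    show "frechet_derivative f (at z) v =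
      integral (cbox 0 1) (\<lambda>t. f (z + (r * cis (2 * pi * t)) *s v) * (cis (- (2 * pi * t)) / r))"
      if "z \<in> ball z0 (e / 2)" for z
      by (rule frechet_derivative_Cauchy[OF assms(1,2) r(1) inS[OF that]])
    show "z + \<zeta> *s v \<in> S" if "z \<in> ball z0 (e / 2)" "cmod \<zeta> \<le> r" for z \<zeta>
      using that by (rule inS)
  qed (use e(1) r(1) in simp_all)
qed

text \<open>
  The integrand in the Cauchy formula depends continuously on \<open>z\<close>.  Continuity of the derivative is
  the hypothesis that differentiation under the integral sign will require.
\<close>

lemma continuous_on_frechet_derivative:
  fixes v :: "complex ^ 'n"
  assumes "cn_holomorphic_on f S" "open S"
  shows "continuous_on S (\<lambda>z. frechet_derivative f (at z) v)"
proof (rule continuous_at_imp_continuous_on, rule ballI)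
  fix z0 assume z0: "z0 \<in> S"
  obtain \<rho> r where *: "0 < \<rho>" "0 < r" "ball z0 \<rho> \<subseteq> S"
      "\<And>z \<zeta>. z \<in> ball z0 \<rho> \<Longrightarrow> cmod \<zeta> \<le> r \<Longrightarrow> z + \<zeta> *s v \<in> S"
      "\<And>z. z \<in> ball z0 \<rho> \<Longrightarrow> frechet_derivative f (at z) v =
      integral (cbox 0 1) (\<lambda>t. f (z + (r * cis (2 * pi * t)) *s v) * (cis (- (2 * pi * t)) / r))"
    by (rule frechet_derivative_Cauchy_nearby[OF assms z0, where v = v]) (rule that; assumption)
  have "continuous_on (ball z0 \<rho>)
      (\<lambda>z. integral (cbox 0 1) (\<lambda>t. f (z + (r * cis (2 * pi * t)) *s v) * (cis (- (2 * pi * t)) / r)))"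
  proof (rule integral_continuous_on_param)
    have "continuous_on (ball z0 \<rho> \<times> cbox 0 1) (\<lambda>(z, t). f (z + (r * cis (2 * pi * t)) *s v))"
      unfolding case_prod_unfold
      by (rule continuous_on_compose2[OF cn_holomorphic_on_imp_continuous_on[OF assms(1)]])
         (use *(2,4) in \<open>auto intro!: continuous_intros simp: norm_mult\<close>)
    then show "continuous_on (ball z0 \<rho> \<times> cbox 0 1)
        (\<lambda>(z, t). f (z + (r * cis (2 * pi * t)) *s v) * (cis (- (2 * pi * t)) / r))"
      using *(2) unfolding case_prod_unfold by (auto intro!: continuous_intros)
  qed
  then have "continuous_on (ball z0 \<rho>) (\<lambda>z. frechet_derivative f (at z) v)"
    by (subst continuous_on_cong[OF refl *(5)])
  then show "isCont (\<lambda>z. frechet_derivative f (at z) v) z0"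
    using *(1) by (simp add: continuous_on_eq_continuous_at)
qed

text \<open>
  Differentiation under the integral sign in the Cauchy formula; the derivative of the integrand is
  complex linear in the increment, hence so is that of the integral.
\<close>

lemma cn_holomorphic_on_frechet_derivative:
  fixes v :: "complex ^ 'n"
  assumes "cn_holomorphic_on f S" "open S"
  shows "cn_holomorphic_on (\<lambda>z. frechet_derivative f (at z) v) S"
  unfolding cn_holomorphic_on_def
proof
  fix z0 assume z0: "z0 \<in> S"
  obtain \<rho> r where *: "0 < \<rho>" "0 < r" "ball z0 \<rho> \<subseteq> S"
      "\<And>z \<zeta>. z \<in> ball z0 \<rho> \<Longrightarrow> cmod \<zeta> \<le> r \<Longrightarrow> z + \<zeta> *s v \<in> S"
      "\<And>z. z \<in> ball z0 \<rho> \<Longrightarrow> frechet_derivative f (at z) v =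
      integral (cbox 0 1) (\<lambda>t. f (z + (r * cis (2 * pi * t)) *s v) * (cis (- (2 * pi * t)) / r))"
    by (rule frechet_derivative_Cauchy_nearby[OF assms z0, where v = v]) (rule that; assumption)
  define D where "D z = Blinfun (frechet_derivative f (at z))" for z
  have D: "blinfun_apply (D z) = frechet_derivative f (at z)" if "z \<in> S" for z
    unfolding D_def using frechet_derivative_holomorphic(1)[OF assms that]
    by (intro bounded_linear_Blinfun_apply has_derivative_bounded_linear)
  have cont_D: "continuous_on S D"
    by (rule continuous_on_blinfun_componentwise)
       (use continuous_on_frechet_derivative[OF assms] D in \<open>simp cong: continuous_on_cong\<close>)
  define \<gamma> where "\<gamma> t = (r * cis (2 * pi * t)) *s v" for t
  define \<kappa> where "\<kappa> t = cis (- (2 * pi * t)) / r" for t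
  define M :: "real \<Rightarrow> complex \<Rightarrow>\<^sub>L complex" where "M t = blinfun_mult_left (\<kappa> t)" for t
  have inS: "z + \<gamma> t \<in> S" if "z \<in> ball z0 \<rho>" for z t
    unfolding \<gamma>_def using *(2) by (intro *(4) that) (simp add: norm_mult)
  have cont_\<gamma>: "continuous_on T \<gamma>" for T
    unfolding \<gamma>_def by (intro continuous_intros)
  have cont_\<kappa>: "continuous_on T \<kappa>" for T
    unfolding \<kappa>_def using *(2) by (intro continuous_intros) auto
  define E where "E z t = M t o\<^sub>L D (z + \<gamma> t)" for z t
  have "((\<lambda>z. integral (cbox 0 1) (\<lambda>t. f (z + \<gamma> t) * \<kappa> t)) has_derivative
      integral (cbox 0 1) (E z0)) (at z0 within ball z0 \<rho>)"
  proof (rule leibniz_rule)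
    fix z t assume "z \<in> ball z0 \<rho>"
    then have "(f has_derivative D (z + \<gamma> t)) (at (z + \<gamma> t))"
      using inS D frechet_derivative_holomorphic(1)[OF assms] by simp
    moreover have "((\<lambda>z. z + \<gamma> t) has_derivative (\<lambda>h. h)) (at z within ball z0 \<rho>)"
      by (auto intro!: derivative_eq_intros)
    ultimately have "((\<lambda>z. f (z + \<gamma> t)) has_derivative D (z + \<gamma> t)) (at z within ball z0 \<rho>)"
      using has_derivative_compose by blast
    then show "((\<lambda>z. f (z + \<gamma> t) * \<kappa> t) has_derivative E z t) (at z within ball z0 \<rho>)"
      unfolding E_def M_def by (auto intro!: derivative_eq_intros)
  next
    fix z assume "z \<in> ball z0 \<rho>"
    then have "continuous_on (cbox 0 1) (\<lambda>t. f (z + \<gamma> t) * \<kappa> t)"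
      by (intro continuous_intros cont_\<gamma> cont_\<kappa>
          continuous_on_compose2[OF cn_holomorphic_on_imp_continuous_on[OF assms(1)]])
         (auto intro: inS)
    then show "(\<lambda>t. f (z + \<gamma> t) * \<kappa> t) integrable_on cbox 0 1"
      by (rule integrable_continuous)
  next
    have "continuous_on (ball z0 \<rho> \<times> cbox 0 1) (\<lambda>x. D (fst x + \<gamma> (snd x)))"
      by (rule continuous_on_compose2[OF cont_D])
         (use inS in \<open>auto intro!: continuous_intros continuous_on_compose2[OF cont_\<gamma>[of UNIV]]\<close>)
    moreover have "continuous_on (ball z0 \<rho> \<times> cbox 0 1) (\<lambda>x. M (snd x))"
      unfolding M_def
      by (intro bounded_linear.continuous_on[OF bounded_linear_blinfun_mult_left]
          continuous_on_compose2[OF cont_\<kappa>[of UNIV]] continuous_intros) auto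
    ultimately show "continuous_on (ball z0 \<rho> \<times> cbox 0 1) (\<lambda>(z, t). E z t)"
      unfolding E_def case_prod_unfold by (intro continuous_intros)
  qed (use *(1) in auto)
  note deriv_integral = this
  have "((\<lambda>z. frechet_derivative f (at z) v) has_derivative integral (cbox 0 1) (E z0))
      (at z0 within ball z0 \<rho>)"
  proof (rule has_derivative_transform[OF _ _ deriv_integral])
    show "z0 \<in> ball z0 \<rho>" using *(1) by simp
    show "frechet_derivative f (at z) v = integral (cbox 0 1) (\<lambda>t. f (z + \<gamma> t) * \<kappa> t)"
      if "z \<in> ball z0 \<rho>" for z
      unfolding \<gamma>_def \<kappa>_def using that by (rule *(5))
  qed
  then have "((\<lambda>z. frechet_derivative f (at z) v) has_derivative integral (cbox 0 1) (E z0)) (at z0)"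
    using *(1) at_within_open[of z0 "ball z0 \<rho>"] by simp
  moreover have "integral (cbox 0 1) (E z0) (c *s u) = c * integral (cbox 0 1) (E z0) u" for c u
  proof -
    have "continuous_on (cbox 0 1) (\<lambda>t. D (z0 + \<gamma> t))"
      by (rule continuous_on_compose2[OF cont_D])
         (use inS *(1) in \<open>auto intro!: continuous_intros cont_\<gamma>\<close>)
    moreover have "continuous_on (cbox 0 1) M"
      unfolding M_def
      by (intro bounded_linear.continuous_on[OF bounded_linear_blinfun_mult_left] cont_\<kappa>)
    ultimately have "E z0 integrable_on cbox 0 1"
      unfolding E_def by (intro integrable_continuous continuous_intros)
    then have "integral (cbox 0 1) (E z0) w = integral (cbox 0 1) (\<lambda>t. E z0 t w)" for w
      by (rule blinfun_apply_integral)
    moreover have "E z0 t (c *s u) = c * E z0 t u" for t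
      using frechet_derivative_holomorphic(2)[OF assms inS[of z0 t]] D[OF inS[of z0 t]] *(1)
      by (simp add: E_def M_def)
    ultimately show ?thesis by simp
  qed
  ultimately show "\<exists>D. ((\<lambda>z. frechet_derivative f (at z) v) has_derivative D) (at z0 within S) \<and>
      (\<forall>c v. D (c *s v) = c * D v)"
    using has_derivative_at_withinI by blast
qed

lemma cn_holomorphic_on_radial_deriv:
  assumes "cn_holomorphic_on f S" "open S"
  shows "cn_holomorphic_on (radial_deriv f) S"
proof (rule cn_holomorphic_on_cong)
  show "cn_holomorphic_on (\<lambda>z. \<Sum>k\<in>UNIV. z $ k * frechet_derivative f (at z) (axis k 1)) S"
    by (rule cn_holomorphic_on_sum, rule cn_holomorphic_on_mult[OF cn_holomorphic_on_component])
       (rule cn_holomorphic_on_frechet_derivative[OF assms])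
next
  fix z assume "z \<in> S"
  then show "radial_deriv f z = (\<Sum>k\<in>UNIV. z $ k * frechet_derivative f (at z) (axis k 1))"
    unfolding radial_deriv_def by (simp only: partial_deriv_eq_frechet_derivative[OF assms])
qed

lemma cn_holomorphic_on_radial_deriv_iterate:
  assumes "cn_holomorphic_on f S" "open S"
  shows "cn_holomorphic_on ((radial_deriv ^^ k) f) S"
  by (induction k) (simp_all add: assms cn_holomorphic_on_radial_deriv)

lemma radial_deriv_0: "radial_deriv f 0 = 0"
  by (simp add: radial_deriv_def)

section \<open>Invariance of Lebesgue measure\<close>

lemma nn_integral_lborel_translation:
  fixes F :: "'a::euclidean_space \<Rightarrow> ennreal"
  assumes [measurable]: "F \<in> borel_measurable borel"
  shows "(\<integral>\<^sup>+x. F (a + x) \<partial>lborel) = (\<integral>\<^sup>+x. F x \<partial>lborel)"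
proof -
  have "(\<integral>\<^sup>+x. F x \<partial>lborel) = (\<integral>\<^sup>+x. F x \<partial>distr lborel borel ((+) a))"
    by (simp add: lborel_distr_plus)
  also have "\<dots> = (\<integral>\<^sup>+x. F (a + x) \<partial>lborel)"
    by (subst nn_integral_distr) auto
  finally show ?thesis by simp
qed

lemma nn_integral_lborel_reflection:
  fixes F :: "'a::euclidean_space \<Rightarrow> ennreal"
  assumes [measurable]: "F \<in> borel_measurable borel"
  shows "(\<integral>\<^sup>+x. F (a - x) \<partial>lborel) = (\<integral>\<^sup>+x. F x \<partial>lborel)"
proof -
  have "(\<integral>\<^sup>+x. F x \<partial>lborel) = (\<integral>\<^sup>+x. F x \<partial>distr lborel borel (\<lambda>x. a + (-1) *\<^sub>R x))"
    using lborel_affine[of "-1" a] by (simp add: density_1)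
  also have "\<dots> = (\<integral>\<^sup>+x. F (a - x) \<partial>lborel)"
    by (subst nn_integral_distr) auto
  finally show ?thesis by simp
qed

text \<open>
  Uniqueness of Haar measure in miniature.  With \<open>B\<close> the unit ball, evaluate
  \<open>\<integral>\<integral> F(Tx) 1\<^sub>B(Tx + y) dx dy\<close> in two ways.  Integrating over \<open>y\<close> first gives
  \<open>vol(B) \<integral> F(Tx) dx\<close>.  Shifting \<open>x\<close> by \<open>T\<^sup>-\<^sup>1 y\<close> first gives
  \<open>\<integral>\<integral> F(Tx - y) 1\<^sub>B(Tx) dx dy = vol(B) \<integral> F\<close>, since \<open>T\<close> preserves \<open>B\<close>.
\<close>

lemma nn_integral_lborel_orthogonal:
  fixes T :: "'a::euclidean_space \<Rightarrow> 'a" and F :: "'a \<Rightarrow> ennreal"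
  assumes T: "orthogonal_transformation T" and [measurable]: "F \<in> borel_measurable borel"
  shows "(\<integral>\<^sup>+x. F (T x) \<partial>lborel) = (\<integral>\<^sup>+x. F x \<partial>lborel)"
proof -
  define B :: "'a \<Rightarrow> ennreal" where "B = indicator (ball 0 1)"
  have [measurable]: "B \<in> borel_measurable borel"
    by (simp add: B_def borel_measurable_indicator)
  define \<beta> where "\<beta> = emeasure lborel (ball (0::'a) 1)"
  have \<beta>: "\<beta> \<noteq> 0" "\<beta> \<noteq> \<infinity>"
    by (simp_all add: \<beta>_def emeasure_ball ennreal_eq_0_iff not_le)
  have lin: "linear T" using T by (simp add: orthogonal_transformation_linear)
  then have [measurable]: "T \<in> borel_measurable borel"
    by (intro borel_measurable_continuous_onI linear_continuous_on)
       (simp add: linear_conv_bounded_linear)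
  have int_B: "(\<integral>\<^sup>+y. B (a + y) \<partial>lborel) = \<beta>" for a
    by (subst nn_integral_lborel_translation, measurable) (simp add: \<beta>_def B_def)
  have "\<beta> * (\<integral>\<^sup>+x. F (T x) \<partial>lborel) = (\<integral>\<^sup>+x. F (T x) * (\<integral>\<^sup>+y. B (T x + y) \<partial>lborel) \<partial>lborel)"
    by (subst nn_integral_cmult[symmetric], measurable) (simp add: int_B mult.commute)
  also have "\<dots> = (\<integral>\<^sup>+x. \<integral>\<^sup>+y. F (T x) * B (T x + y) \<partial>lborel \<partial>lborel)"
    by (intro nn_integral_cong nn_integral_cmult[symmetric]) measurable
  also have "\<dots> = (\<integral>\<^sup>+y. \<integral>\<^sup>+x. F (T x) * B (T x + y) \<partial>lborel \<partial>lborel)"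
    by (rule lborel_pair.Fubini') measurable
  also have "\<dots> = (\<integral>\<^sup>+y. \<integral>\<^sup>+x. F (T x - y) * B (T x) \<partial>lborel \<partial>lborel)"
  proof (rule nn_integral_cong)
    fix y :: 'a
    obtain s where s: "T s = y"
      using orthogonal_transformation_surj[OF T] by (metis surjD)
    have "(\<integral>\<^sup>+x. F (T x - y) * B (T x) \<partial>lborel)
        = (\<integral>\<^sup>+x. F (T (s + x) - y) * B (T (s + x)) \<partial>lborel)"
      by (subst nn_integral_lborel_translation[where a = s]) auto
    then show "(\<integral>\<^sup>+x. F (T x) * B (T x + y) \<partial>lborel) = (\<integral>\<^sup>+x. F (T x - y) * B (T x) \<partial>lborel)"
      by (simp add: linear_add[OF lin] s add.commute)
  qed
  also have "\<dots> = (\<integral>\<^sup>+x. \<integral>\<^sup>+y. F (T x - y) * B (T x) \<partial>lborel \<partial>lborel)"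
    by (rule lborel_pair.Fubini') measurable
  also have "\<dots> = (\<integral>\<^sup>+x. B (T x) * (\<integral>\<^sup>+y. F y \<partial>lborel) \<partial>lborel)"
    by (intro nn_integral_cong)
       (subst nn_integral_multc, measurable, simp add: nn_integral_lborel_reflection mult.commute)
  also have "\<dots> = \<beta> * (\<integral>\<^sup>+y. F y \<partial>lborel)"
    using orthogonal_transformation_norm[OF T] int_B[of 0]
    by (simp add: nn_integral_multc B_def indicator_def)
  finally show ?thesis
    using \<beta> by (simp add: ennreal_mult_cancel_left)
qed


section \<open>Averaging over circular sets\<close>

text \<open>
  Average the circle inequality for \<open>\<zeta> \<mapsto> g(z + \<zeta> w)\<close> over \<open>w \<in> E\<close>.  After interchanging the
  integrals, each rotation \<open>w \<mapsto> c w\<close> with \<open>|c| = 1\<close> preserves both \<open>E\<close> and Lebesgue measure, so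
  that all the inner integrals coincide.
\<close>

lemma submean_circular:
  fixes g :: "complex ^ 'n \<Rightarrow> complex"
  assumes hol: "cn_holomorphic_on g S" "open S" and "p > 0"
    and [measurable]: "E \<in> sets borel"
    and circular: "\<And>c w. cmod c = 1 \<Longrightarrow> w \<in> E \<Longrightarrow> c *s w \<in> E"
    and disc: "\<And>\<zeta> w. cmod \<zeta> \<le> 1 \<Longrightarrow> w \<in> E \<Longrightarrow> z + \<zeta> *s w \<in> S"
  shows "ennreal (cmod (g z) powr p) * emeasure lborel E
    \<le> (\<integral>\<^sup>+w. ennreal (cmod (g (z + w)) powr p) * indicator E w \<partial>lborel)"
proof -
  \<comment> \<open>Cutting off outside \<open>S\<close> makes the integrand Borel measurable on the whole space.\<close>
  define G where "G w = ennreal (cmod (indicator S w *\<^sub>R g w) powr p)" for w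
  have "(\<lambda>w. indicator S w *\<^sub>R g w) \<in> borel_measurable borel"
    by (rule borel_measurable_continuous_on_indicator)
       (use hol in \<open>auto intro: cn_holomorphic_on_imp_continuous_on\<close>)
  then have [measurable]: "G \<in> borel_measurable borel"
    unfolding G_def by measurable
  have G_S: "G w = ennreal (cmod (g w) powr p)" if "w \<in> S" for w
    using that by (simp add: G_def)
  define c where "c t = cis (2 * pi * t)" for t
  have "continuous_on UNIV (\<lambda>x. z + c (snd x) *s fst x)"
    unfolding c_def by (intro continuous_intros)
  from borel_measurable_continuous_onI[OF this]
  have [measurable]: "(\<lambda>x. z + c (snd x) *s fst x) \<in> borel_measurable (borel \<Otimes>\<^sub>M borel)"
    by (simp add: borel_prod)
  have meas: "(\<lambda>(w, t). G (z + c t *s w) * indicator {0..1} t * indicator E w)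
      \<in> borel_measurable (lborel \<Otimes>\<^sub>M lborel)"
    unfolding case_prod_unfold by measurable
  have le: "ennreal (cmod (g z) powr p) * indicator E w
      \<le> (\<integral>\<^sup>+t. G (z + c t *s w) * indicator {0..1} t * indicator E w \<partial>lborel)" for w
  proof (cases "w \<in> E")
    case True
    let ?h = "\<lambda>\<zeta>. g (z + \<zeta> *s w)"
    have h: "?h holomorphic_on cball 0 1"
      by (rule holomorphic_on_along_line[OF hol]) (use disc True in auto)
    then have cont: "continuous_on (cball 0 1) ?h"
      by (rule holomorphic_on_imp_continuous_on)
    have "continuous_on {0..1} (\<lambda>t. ?h (c t))"
      unfolding c_def by (rule continuous_on_compose2[OF cont]) (auto intro!: continuous_intros)
    then have "(\<lambda>t. cmod (?h (c t)) powr p) integrable_on {0..1}"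
      using \<open>p > 0\<close> by (intro integrable_continuous_real continuous_on_powr' continuous_intros) auto
    note int = integrable_integral[OF this]
    have "cmod (?h 0) powr p \<le> integral {0..1} (\<lambda>t. cmod (?h (c t)) powr p)"
      unfolding c_def using h cont \<open>p > 0\<close>
      by (intro circle_submean_powr) (auto intro: holomorphic_on_subset)
    then have "ennreal (cmod (g z) powr p) \<le> ennreal (integral {0..1} (\<lambda>t. cmod (?h (c t)) powr p))"
      by (intro ennreal_leI) simp
    also have "\<dots> = (\<integral>\<^sup>+t. ennreal (cmod (?h (c t)) powr p) * indicator {0..1} t \<partial>lborel)"
      by (rule nn_integral_has_integral_lebesgue'[symmetric]) (use int in auto)
    also have "\<dots> = (\<integral>\<^sup>+t. G (z + c t *s w) * indicator {0..1} t * indicator E w \<partial>lborel)"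
      using True disc by (intro nn_integral_cong) (simp add: G_S c_def)
    finally show ?thesis using True by simp
  qed simp
  have "ennreal (cmod (g z) powr p) * emeasure lborel E
      = (\<integral>\<^sup>+w. ennreal (cmod (g z) powr p) * indicator E w \<partial>lborel)"
    by (simp add: nn_integral_cmult_indicator)
  also have "\<dots> \<le> (\<integral>\<^sup>+w. \<integral>\<^sup>+t. G (z + c t *s w) * indicator {0..1} t * indicator E w \<partial>lborel \<partial>lborel)"
    by (intro nn_integral_mono le)
  also have "\<dots> = (\<integral>\<^sup>+t. \<integral>\<^sup>+w. G (z + c t *s w) * indicator {0..1} t * indicator E w \<partial>lborel \<partial>lborel)"
    using lborel_pair.Fubini'[OF meas] by simp
  also have "\<dots> = (\<integral>\<^sup>+t. indicator {0..1::real} t * (\<integral>\<^sup>+w. G (z + w) * indicator E w \<partial>lborel) \<partial>lborel)"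
  proof (rule nn_integral_cong)
    fix t :: real
    have c1: "cmod (c t) = 1" "cmod (inverse (c t)) = 1" "c t \<noteq> 0" by (simp_all add: c_def norm_inverse)
    have "c t *s w \<in> E \<longleftrightarrow> w \<in> E" for w
      using circular[OF c1(1), of w] circular[OF c1(2), of "c t *s w"] c1(3) by auto
    then have ind: "indicator E (c t *s w) = (indicator E w :: ennreal)" for w
      by (simp add: indicator_def)
    have "orthogonal_transformation ((*s) (c t) :: complex ^ 'n \<Rightarrow> _)"
      unfolding orthogonal_transformation
      using bounded_linear.linear[OF
          bounded_bilinear.bounded_linear_right[OF bounded_bilinear_complex_smult]]
      by (simp add: norm_complex_smult c1)
    then have "(\<integral>\<^sup>+w. G (z + c t *s w) * indicator E (c t *s w) \<partial>lborel)
        = (\<integral>\<^sup>+w. G (z + w) * indicator E w \<partial>lborel)"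
      by (rule nn_integral_lborel_orthogonal) measurable
    then show "(\<integral>\<^sup>+w. G (z + c t *s w) * indicator {0..1} t * indicator E w \<partial>lborel)
        = indicator {0..1} t * (\<integral>\<^sup>+w. G (z + w) * indicator E w \<partial>lborel)"
      by (cases "t \<in> {0..1}") (simp_all add: ind)
  qed
  also have "\<dots> = (\<integral>\<^sup>+w. G (z + w) * indicator E w \<partial>lborel)"
    by (simp add: nn_integral_multc)
  also have "\<dots> = (\<integral>\<^sup>+w. ennreal (cmod (g (z + w)) powr p) * indicator E w \<partial>lborel)"
    using disc[of 1] by (intro nn_integral_cong) (auto simp: indicator_def G_S)
  finally show ?thesis .
qed


section \<open>Non-isotropic neighbourhoods and the weighted pointwise bound\<close>

text \<open>
  The Hermitian inner product, linear in the first argument.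
\<close>

definition cinner :: "complex ^ 'n \<Rightarrow> complex ^ 'n \<Rightarrow> complex"
  where "cinner w z = (\<Sum>k\<in>UNIV. w $ k * cnj (z $ k))"

lemma cinner_smult_left: "cinner (c *s w) z = c * cinner w z"
  by (simp add: cinner_def sum_distrib_left mult.assoc)

lemma cinner_diff_left: "cinner (w - u) z = cinner w z - cinner u z"
  by (simp add: cinner_def sum_subtractf left_diff_distrib)

lemma Re_cinner: "Re (cinner w z) = w \<bullet> z"
  by (simp add: cinner_def inner_vec_def inner_complex_def Re_sum)

lemma abs_Re_Im_cinner_le:
  "\<bar>Re (cinner w z)\<bar> \<le> norm w * norm z" "\<bar>Im (cinner w z)\<bar> \<le> norm w * norm z"
proof -
  show "\<bar>Re (cinner w z)\<bar> \<le> norm w * norm z" for w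
    by (simp add: Re_cinner Cauchy_Schwarz_ineq2)
  from this[of "(- \<i>) *s w"] show "\<bar>Im (cinner w z)\<bar> \<le> norm w * norm z"
    unfolding cinner_smult_left norm_complex_smult by simp
qed

lemma continuous_on_cinner [continuous_intros]: "continuous_on S (\<lambda>w. cinner w z)"
  unfolding cinner_def by (intro continuous_intros)

text \<open>
  The non-isotropic neighbourhood of \<open>0\<close> attached to \<open>z\<close>.  The inner product with \<open>z\<close> itself, not
  with \<open>z / |z|\<close>, is constrained: for \<open>z\<close> near the boundary this makes no difference of order, and
  no case distinction at \<open>z = 0\<close> arises.  The constants \<open>1/2\<close> and \<open>1/8\<close> are chosen so that
  \<open>1 - |z + w|\<^sup>2\<close> differs from \<open>1 - |z|\<^sup>2\<close> by at most half of the latter.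
\<close>

definition slab :: "complex ^ 'n \<Rightarrow> (complex ^ 'n) set"
  where "slab z = {w. norm w \<le> sqrt (1 - (norm z)\<^sup>2) / 2 \<and> cmod (cinner w z) \<le> (1 - (norm z)\<^sup>2) / 8}"

lemma slab_borel: "slab z \<in> sets borel"
proof -
  have "closed {w. norm w \<le> sqrt (1 - (norm z)\<^sup>2) / 2}"
    "closed {w. cmod (cinner w z) \<le> (1 - (norm z)\<^sup>2) / 8}"
    by (intro closed_Collect_le continuous_intros)+
  then have "closed (slab z)"
    unfolding slab_def Collect_conj_eq by (rule closed_Int)
  then show ?thesis by simp
qed

lemma slab_smult:
  assumes "cmod \<zeta> \<le> 1" "w \<in> slab z"
  shows "\<zeta> *s w \<in> slab z"
proof -
  have "cmod \<zeta> * norm w \<le> norm w" "cmod \<zeta> * cmod (cinner w z) \<le> cmod (cinner w z)"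
    using assms(1) by (simp_all add: mult_left_le_one_le)
  then show ?thesis
    using assms(2) unfolding slab_def
    by (auto simp: norm_complex_smult cinner_smult_left norm_mult)
qed

text \<open>
  In \<open>|z + w|\<^sup>2 = |z|\<^sup>2 + 2 Re \<langle>w, z\<rangle> + |w|\<^sup>2\<close> each of the last two terms is bounded by a quarter of
  \<open>1 - |z|\<^sup>2\<close>.
\<close>

lemma slab_translate_defect:
  assumes "norm z < 1" "w \<in> slab z"
  shows "(1 - (norm z)\<^sup>2) / 2 \<le> 1 - (norm (z + w))\<^sup>2"
    and "1 - (norm (z + w))\<^sup>2 \<le> 2 * (1 - (norm z)\<^sup>2)"
proof -
  let ?\<delta> = "1 - (norm z)\<^sup>2"
  have \<delta>: "?\<delta> > 0" using assms(1) by (simp add: abs_square_less_1)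
  have "(norm w)\<^sup>2 \<le> (sqrt ?\<delta> / 2)\<^sup>2"
    using assms(2) by (intro power_mono) (auto simp: slab_def)
  then have w2: "(norm w)\<^sup>2 \<le> ?\<delta> / 4" using \<delta> by (simp add: power_divide)
  have "\<bar>z \<bullet> w\<bar> \<le> ?\<delta> / 8"
    using assms(2) abs_Re_le_cmod[of "cinner w z"]
    by (simp add: slab_def Re_cinner inner_commute)
  then have "z \<bullet> w \<le> ?\<delta> / 8" "- (?\<delta> / 8) \<le> z \<bullet> w" by linarith+
  moreover have "(norm (z + w))\<^sup>2 = 1 - ?\<delta> + 2 * (z \<bullet> w) + (norm w)\<^sup>2"
    by (simp add: power2_norm_eq_inner inner_add inner_commute)
  moreover have "d / 2 \<le> 1 - c" "1 - c \<le> 2 * d"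
    if "b \<le> d / 8" "- (d / 8) \<le> b" "c = 1 - d + 2 * b + e" "0 \<le> e" "e \<le> d / 4" "0 < d"
    for b c d e :: real
    using that by auto
  ultimately show "?\<delta> / 2 \<le> 1 - (norm (z + w))\<^sup>2" "1 - (norm (z + w))\<^sup>2 \<le> 2 * ?\<delta>"
    using w2 \<delta> zero_le_power2[of "norm w"] by blast+
qed

text \<open>
  Let \<open>\<delta> = 1 - |z|\<^sup>2\<close>.  Cut the ball of radius \<open>\<surd>\<delta> / 4\<close>, whose volume is of order \<open>\<delta>\<^sup>n\<close>, into
  cells according to which square of side \<open>\<delta> / 16\<close> contains \<open>\<langle>w, z\<rangle>\<close>.  There are at most
  \<open>121 / \<delta>\<close> cells, and two points of one cell differ by an element of the slab, so that each cell
  lies in a translate of it.  Hence the slab has at least \<open>\<delta> / 121\<close> times the volume of the ball.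
\<close>

lemma emeasure_slab_ge:
  fixes z :: "complex ^ 'n"
  assumes "norm z < 1"
  shows "ennreal (unit_ball_vol (2 * real CARD('n)) / (121 * 16 ^ CARD('n)) *
    (1 - (norm z)\<^sup>2) ^ (CARD('n) + 1)) \<le> emeasure lborel (slab z)"
proof -
  define \<delta> where "\<delta> = 1 - (norm z)\<^sup>2"
  have \<delta>: "0 < \<delta>" "\<delta> \<le> 1" using assms by (auto simp: \<delta>_def abs_square_less_1)
  define s where "s = sqrt \<delta> / 4"
  define \<eta> where "\<eta> = \<delta> / 16"
  have s\<eta>: "s > 0" "\<eta> > 0" using \<delta> by (auto simp: s_def \<eta>_def)
  define m where "m = \<lceil>s / \<eta>\<rceil>"
  define I where "I = {-m..m}"
  define cell where "cell ij = {w \<in> ball 0 s. \<lfloor>Re (cinner w z) / \<eta>\<rfloor> = fst ij \<and> \<lfloor>Im (cinner w z) / \<eta>\<rfloor> = snd ij}"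
    for ij :: "int \<times> int"
  have "(\<lambda>w. cinner w z) \<in> borel_measurable borel"
    by (intro borel_measurable_continuous_onI continuous_intros)
  then have [measurable]: "(\<lambda>w. \<lfloor>Re (cinner w z) / \<eta>\<rfloor>) \<in> measurable borel (count_space UNIV)"
     "(\<lambda>w. \<lfloor>Im (cinner w z) / \<eta>\<rfloor>) \<in> measurable borel (count_space UNIV)"
    by measurable
  have cell_borel: "cell ij \<in> sets borel" for ij
    unfolding cell_def by measurable
  note [measurable] = slab_borel[of z]
  have fin: "emeasure lborel (slab z) \<noteq> \<infinity>"
  proof -
    have "slab z \<subseteq> cball 0 (sqrt \<delta> / 2)" by (auto simp: slab_def \<delta>_def)
    then have "bounded (slab z)" by (rule bounded_subset[OF bounded_cball])
    from emeasure_bounded_finite[OF this] show ?thesis by simp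
  qed
  have floor_mem: "\<lfloor>x / \<eta>\<rfloor> \<in> I" if "\<bar>x\<bar> \<le> s" for x
  proof -
    have "x / \<eta> \<le> s / \<eta>" "- (s / \<eta>) \<le> x / \<eta>" using that s\<eta> by (auto simp: field_simps)
    then show ?thesis unfolding I_def m_def by (auto intro: floor_mono simp: le_floor_iff) linarith+
  qed
  have cover: "ball 0 s \<subseteq> (\<Union>ij\<in>I \<times> I. cell ij)"
  proof
    fix w :: "complex ^ 'n" assume w: "w \<in> ball 0 s"
    have "norm w * norm z \<le> s * 1" using w assms s\<eta> by (intro mult_mono) auto
    with abs_Re_Im_cinner_le[of w z] have "\<bar>Re (cinner w z)\<bar> \<le> s" "\<bar>Im (cinner w z)\<bar> \<le> s" by auto
    with floor_mem w show "w \<in> (\<Union>ij\<in>I \<times> I. cell ij)" by (auto simp: cell_def)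
  qed
  have cell_le: "emeasure lborel (cell ij) \<le> emeasure lborel (slab z)" for ij
  proof (cases "cell ij = {}")
    case False
    then obtain u where u: "u \<in> cell ij" by blast
    have sub: "x \<in> slab z" if "u + x \<in> cell ij" for x
    proof -
      have close: "\<bar>a - b\<bar> \<le> \<eta>" if "\<lfloor>a / \<eta>\<rfloor> = \<lfloor>b / \<eta>\<rfloor>" for a b
      proof -
        have "\<bar>a / \<eta> - b / \<eta>\<bar> \<le> 1" using that by linarith
        then show ?thesis using s\<eta> by (simp add: field_simps abs_if split: if_splits)
      qed
      have "norm x \<le> norm (u + x) + norm u"
        using norm_triangle_ineq4[of "u + x" u] by simp
      also have "\<dots> \<le> sqrt \<delta> / 2" using that u by (auto simp: cell_def s_def)
      finally have 1: "norm x \<le> sqrt \<delta> / 2" .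
      have eq: "cinner x z = cinner (u + x) z - cinner u z"
        using cinner_diff_left[of "u + x" u z] by simp
      have "\<bar>Re (cinner x z)\<bar> \<le> \<eta>" "\<bar>Im (cinner x z)\<bar> \<le> \<eta>"
        unfolding eq using that u by (auto simp: cell_def intro!: close)
      then have "cmod (cinner x z) \<le> \<eta> + \<eta>"
        using cmod_le[of "cinner x z"] by linarith
      with 1 show ?thesis by (simp add: slab_def \<eta>_def flip: \<delta>_def)
    qed
    have "emeasure lborel (cell ij) = (\<integral>\<^sup>+x. indicator (cell ij) (u + x) \<partial>lborel)"
      using cell_borel by (subst nn_integral_lborel_translation) auto
    also have "\<dots> \<le> (\<integral>\<^sup>+x. indicator (slab z) x \<partial>lborel)"
      by (intro nn_integral_mono) (auto simp: indicator_def sub)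
    finally show ?thesis by simp
  qed simp
  have "emeasure lborel (ball (0 :: complex ^ 'n) s) \<le> emeasure lborel (\<Union>ij\<in>I \<times> I. cell ij)"
    using cell_borel by (intro emeasure_mono cover) auto
  also have "\<dots> \<le> (\<Sum>ij\<in>I \<times> I. emeasure lborel (cell ij))"
    using cell_borel by (intro emeasure_subadditive_finite) (auto simp: I_def)
  also have "\<dots> \<le> of_nat (card (I \<times> I)) * emeasure lborel (slab z)"
    by (intro sum_bounded_above cell_le)
  also have "\<dots> = ennreal (real (card (I \<times> I)) * measure lborel (slab z))"
    using fin by (simp add: emeasure_eq_ennreal_measure ennreal_mult' ennreal_of_nat_eq_real_of_nat top_unique)
  finally have "unit_ball_vol (2 * real CARD('n)) * s ^ (2 * CARD('n))
      \<le> real (card (I \<times> I)) * measure lborel (slab z)"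
    using s\<eta> by (simp add: emeasure_ball mult.commute[of _ 2])
  also have "s ^ (2 * CARD('n)) = (\<delta> / 16) ^ CARD('n)"
    using \<delta> by (simp add: power_mult s_def power_divide)
  also have "real (card (I \<times> I)) * measure lborel (slab z) \<le> 121 / \<delta> * measure lborel (slab z)"
  proof (rule mult_right_mono)
    have q: "0 < sqrt \<delta>" "sqrt \<delta> \<le> 1" "sqrt \<delta> * sqrt \<delta> = \<delta>" using \<delta> by auto
    have "s / \<eta> = 4 / sqrt \<delta>"
      using q by (simp add: s_def \<eta>_def field_simps)
    moreover have "0 < s / \<eta>" using s\<eta> by simp
    ultimately have m: "real_of_int m \<le> 4 / sqrt \<delta> + 1" "m \<ge> 0"
      unfolding m_def by linarith+
    have "1 \<le> 1 / sqrt \<delta>" using q by simp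
    then have "2 * real_of_int m + 1 \<le> 11 / sqrt \<delta>" using m(1) by (simp add: add_divide_distrib) 
    then have "(2 * real_of_int m + 1) * (2 * real_of_int m + 1) \<le> 11 / sqrt \<delta> * (11 / sqrt \<delta>)"
      using m(2) q by (intro mult_mono) auto
    then show "real (card (I \<times> I)) \<le> 121 / \<delta>"
      using m(2) q by (simp add: I_def card_cartesian_product)
  qed simp
  finally have "unit_ball_vol (2 * real CARD('n)) / (121 * 16 ^ CARD('n)) * \<delta> ^ (CARD('n) + 1)
      \<le> measure lborel (slab z)"
    using \<delta> by (simp add: field_simps power_divide)
  then show ?thesis
    using fin by (simp add: emeasure_eq_ennreal_measure ennreal_leI top_unique flip: \<delta>_def)
qed

lemma powr_comparable:
  fixes x y \<gamma> :: real
  assumes "y > 0" "y / 2 \<le> x" "x \<le> 2 * y"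
  shows "y powr \<gamma> \<le> 2 powr \<bar>\<gamma>\<bar> * x powr \<gamma>"
proof -
  have "x > 0" using assms by linarith
  then have "ln (y / 2) \<le> ln x" "ln x \<le> ln (2 * y)"
    using assms by (simp_all add: ln_mono)
  then have "\<bar>ln y - ln x\<bar> \<le> ln 2"
    using assms by (simp add: ln_div ln_mult abs_le_iff)
  then have "\<bar>\<gamma>\<bar> * \<bar>ln y - ln x\<bar> \<le> \<bar>\<gamma>\<bar> * ln 2" by (intro mult_left_mono) auto
  then have "\<gamma> * (ln y - ln x) \<le> \<bar>\<gamma>\<bar> * ln 2"
    by (metis abs_ge_self abs_mult order_trans)
  then have "\<gamma> * ln y \<le> \<bar>\<gamma>\<bar> * ln 2 + \<gamma> * ln x"
    by (simp add: right_diff_distrib)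
  then show ?thesis
    using assms \<open>x > 0\<close> by (simp add: powr_def flip: exp_add)
qed

text \<open>
  Apply the averaging inequality to the slab, where the weight is comparable to its value at \<open>z\<close>.
\<close>

lemma weighted_pointwise_bound:
  fixes p \<gamma> :: real
  assumes "p > 0"
  obtains C where "C > 0"
    and "\<And>(g :: complex ^ 'n \<Rightarrow> complex) z. cn_holomorphic_on g (ball 0 1) \<Longrightarrow> norm z < 1 \<Longrightarrow>
      ennreal (cmod (g z) powr p * (1 - (norm z)\<^sup>2) powr (real CARD('n) + 1 + \<gamma>)) \<le>
      ennreal C * (\<integral>\<^sup>+w. ennreal ((1 - (norm w)\<^sup>2) powr \<gamma> * cmod (g w) powr p) * indicator (ball 0 1) w \<partial>lborel)"
proof -
  define c where "c = unit_ball_vol (2 * real CARD('n)) / (121 * 16 ^ CARD('n))"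
  have c: "c > 0" by (simp add: c_def)
  have "ennreal (cmod (g z) powr p * (1 - (norm z)\<^sup>2) powr (real CARD('n) + 1 + \<gamma>)) \<le>
      ennreal (2 powr \<bar>\<gamma>\<bar> / c) *
      (\<integral>\<^sup>+w. ennreal ((1 - (norm w)\<^sup>2) powr \<gamma> * cmod (g w) powr p) * indicator (ball 0 1) w \<partial>lborel)"
    (is "_ \<le> _ * ?I")
    if g: "cn_holomorphic_on g (ball 0 1)" and z: "norm z < 1"
    for g :: "complex ^ 'n \<Rightarrow> complex" and z
  proof -
    define \<delta> where "\<delta> = 1 - (norm z)\<^sup>2"
    have \<delta>: "0 < \<delta>" using z by (auto simp: \<delta>_def abs_square_less_1)
    define F where "F w = ennreal ((1 - (norm w)\<^sup>2) powr \<gamma> * cmod (g w) powr p) * indicator (ball 0 1) w"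
      for w :: "complex ^ 'n"
    \<comment> \<open>Cutting off outside the ball makes the integrands Borel measurable on the whole space.\<close>
    define g0 where "g0 w = indicator (ball 0 1) w *\<^sub>R g w" for w
    have F_eq: "F w = ennreal ((1 - (norm w)\<^sup>2) powr \<gamma> * cmod (g0 w) powr p)" for w
      using \<open>p > 0\<close> by (simp add: F_def g0_def indicator_def)
    have [measurable]: "g0 \<in> borel_measurable borel"
      unfolding g0_def[abs_def] by (rule borel_measurable_continuous_on_indicator)
         (use g in \<open>auto intro: cn_holomorphic_on_imp_continuous_on\<close>)
    have [measurable]: "F \<in> borel_measurable borel"
      unfolding F_eq[abs_def] by measurable
    note [measurable] = slab_borel[of z]
    have inball: "z + w \<in> ball 0 1" if "w \<in> slab z" for w
      using slab_translate_defect(1)[OF z that] \<delta>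
      using abs_square_less_1[of "norm (z + w)"] by (simp add: \<delta>_def)
    have "ennreal (c * \<delta> ^ (CARD('n) + 1)) * ennreal (cmod (g z) powr p)
        \<le> ennreal (cmod (g z) powr p) * emeasure lborel (slab z)"
      using emeasure_slab_ge[OF z] by (subst mult.commute, intro mult_left_mono) (auto simp: c_def \<delta>_def)
    also have "\<dots> \<le> (\<integral>\<^sup>+w. ennreal (cmod (g (z + w)) powr p) * indicator (slab z) w \<partial>lborel)"
      by (rule submean_circular[OF g open_ball \<open>p > 0\<close> slab_borel])
         (simp_all only: inball slab_smult order_refl)
    finally have "ennreal (\<delta> powr \<gamma>) * (ennreal (c * \<delta> ^ (CARD('n) + 1)) * ennreal (cmod (g z) powr p))
        \<le> ennreal (\<delta> powr \<gamma>) * (\<integral>\<^sup>+w. ennreal (cmod (g (z + w)) powr p) * indicator (slab z) w \<partial>lborel)"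
      by (rule mult_left_mono) simp
    also have "\<dots> = (\<integral>\<^sup>+w. ennreal (\<delta> powr \<gamma>) *
        (ennreal (cmod (g0 (z + w)) powr p) * indicator (slab z) w) \<partial>lborel)"
    proof (subst nn_integral_cmult)
      show "ennreal (\<delta> powr \<gamma>) * (\<integral>\<^sup>+w. ennreal (cmod (g (z + w)) powr p) * indicator (slab z) w \<partial>lborel)
        = ennreal (\<delta> powr \<gamma>) * (\<integral>\<^sup>+w. ennreal (cmod (g0 (z + w)) powr p) * indicator (slab z) w \<partial>lborel)"
      proof -
        have "ennreal (cmod (g (z + w)) powr p) * indicator (slab z) w
            = ennreal (cmod (g0 (z + w)) powr p) * indicator (slab z) w" for w
          using inball[of w] by (simp add: indicator_def g0_def)
        then show ?thesis by simp
      qed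
    qed measurable
    also have "\<dots> \<le> (\<integral>\<^sup>+w. ennreal (2 powr \<bar>\<gamma>\<bar>) * F (z + w) \<partial>lborel)"
    proof (rule nn_integral_mono)
      fix w :: "complex ^ 'n"
      show "ennreal (\<delta> powr \<gamma>) *
          (ennreal (cmod (g0 (z + w)) powr p) * indicator (slab z) w)
        \<le> ennreal (2 powr \<bar>\<gamma>\<bar>) * F (z + w)"
      proof (cases "w \<in> slab z")
        case True
        have "\<delta> powr \<gamma> \<le> 2 powr \<bar>\<gamma>\<bar> * (1 - (norm (z + w))\<^sup>2) powr \<gamma>"
          using slab_translate_defect[OF z True] \<delta> by (intro powr_comparable) (auto simp: \<delta>_def)
        then have "\<delta> powr \<gamma> * cmod (g (z + w)) powr p
            \<le> 2 powr \<bar>\<gamma>\<bar> * (1 - (norm (z + w))\<^sup>2) powr \<gamma> * cmod (g (z + w)) powr p"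
          by (intro mult_right_mono) auto
        then show ?thesis
          using True inball[OF True]
          by (simp add: F_eq g0_def mult.assoc flip: ennreal_mult)
      qed simp
    qed
    also have "\<dots> = ennreal (2 powr \<bar>\<gamma>\<bar>) * ?I"
      by (simp add: nn_integral_cmult nn_integral_lborel_translation) (simp add: F_def)
    finally have "ennreal (1 / c) * (ennreal (\<delta> powr \<gamma>) * (ennreal (c * \<delta> ^ (CARD('n) + 1)) * ennreal (cmod (g z) powr p)))
        \<le> ennreal (1 / c) * (ennreal (2 powr \<bar>\<gamma>\<bar>) * ?I)"
      by (rule mult_left_mono) simp
    moreover have "ennreal (1 / c) * (ennreal (\<delta> powr \<gamma>) * (ennreal (c * \<delta> ^ (CARD('n) + 1)) * ennreal (cmod (g z) powr p)))
        = ennreal (cmod (g z) powr p * \<delta> powr (real CARD('n) + 1 + \<gamma>))"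
    proof -
      have "\<delta> ^ (CARD('n) + 1) = \<delta> powr (real CARD('n) + 1)"
        using powr_realpow[OF \<delta>, of "CARD('n) + 1"] by (simp add: add.commute)
      then have "1 / c * (\<delta> powr \<gamma> * (c * \<delta> ^ (CARD('n) + 1) * cmod (g z) powr p))
          = cmod (g z) powr p * \<delta> powr (real CARD('n) + 1 + \<gamma>)"
        using c by (simp add: powr_add[of \<delta> "real CARD('n) + 1" \<gamma>])
      then show ?thesis using c \<delta> by (simp flip: ennreal_mult)
    qed
    moreover have "ennreal (1 / c) * (ennreal (2 powr \<bar>\<gamma>\<bar>) * ?I) = ennreal (2 powr \<bar>\<gamma>\<bar> / c) * ?I"
      using c by (simp flip: ennreal_mult mult.assoc)
    ultimately show ?thesis by (simp add: \<delta>_def)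
  qed
  with c show thesis by (intro that[of "2 powr \<bar>\<gamma>\<bar> / c"]) auto
qed

section \<open>Integration of radial derivatives\<close>

text \<open>
  Let \<open>d(\<zeta>)\<close> be the derivative of \<open>\<zeta> \<mapsto> u(\<zeta> z)\<close>; then \<open>\<zeta> d(\<zeta>) = (Ru)(\<zeta> z)\<close>.  The factor \<open>\<zeta>\<close> is
  harmless for \<open>|\<zeta>| \<ge> 1/2\<close>, and for \<open>|\<zeta>| \<le> 1/2\<close> the maximum principle carries the bound inwards.
  To integrate over \<open>[0, 1]\<close> with a constant independent of \<open>z\<close>, the factor \<open>1 - t\<^sup>2 r\<close> with
  \<open>r = |z|\<^sup>2\<close> is replaced by the comparable \<open>2 - r - t = (1 - r) + (1 - t)\<close>: powers of the latter
  have an antiderivative in \<open>t\<close> without the factor \<open>1 / r\<close>, which would blow up at \<open>z = 0\<close>.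
\<close>

lemma radial_growth_integration:
  fixes u :: "complex ^ 'n \<Rightarrow> complex"
  assumes hol: "cn_holomorphic_on u (ball 0 1)" and "b > 0" "A \<ge> 0"
    and bound: "\<And>z. norm z < 1 \<Longrightarrow> cmod (radial_deriv u z) \<le> A * (1 - (norm z)\<^sup>2) powr (- (b + 1))"
    and z: "norm z < 1"
  shows "cmod (u z) \<le> cmod (u 0) + 2 * 4 powr (b + 1) / b * A * (1 - (norm z)\<^sup>2) powr (- b)"
proof -
  define r where "r = (norm z)\<^sup>2"
  have r: "0 \<le> r" "r < 1" using z by (auto simp: r_def abs_square_less_1)
  define d where "d \<zeta> = frechet_derivative u (at (\<zeta> *s z)) z" for \<zeta>
  have inball: "\<zeta> *s z \<in> ball 0 1" if "cmod \<zeta> \<le> 1" for \<zeta>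
    using mult_mono[OF that z[THEN less_imp_le]] z that mult_left_le_one_le[of "norm z" "cmod \<zeta>"]
    by (simp add: norm_complex_smult)
  have deriv: "((\<lambda>\<zeta>. u (\<zeta> *s z)) has_field_derivative d \<zeta>) (at \<zeta>)" if "cmod \<zeta> \<le> 1" for \<zeta>
    using has_field_derivative_along_line[OF hol open_ball, of 0 \<zeta> z] inball[OF that] by (simp add: d_def)
  have rad: "radial_deriv u (\<zeta> *s z) = \<zeta> * d \<zeta>" if "cmod \<zeta> \<le> 1" for \<zeta>
    using radial_deriv_eq_frechet_derivative[OF hol open_ball inball[OF that]]
      frechet_derivative_holomorphic(2)[OF hol open_ball inball[OF that]] by (simp add: d_def)
  have d_bound: "cmod \<zeta> * cmod (d \<zeta>) \<le> A * (1 - (cmod \<zeta>)\<^sup>2 * r) powr (- (b + 1))" if "cmod \<zeta> \<le> 1" for \<zeta>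
    using bound[of "\<zeta> *s z"] inball[OF that] rad[OF that]
    by (simp add: norm_complex_smult norm_mult r_def power_mult_distrib)
  \<comment> \<open>One factor \<open>2\<close> pays for \<open>1 / |\<zeta>|\<close>; the power of \<open>4\<close> is what the range \<open>t \<le> 1/2\<close> needs.\<close>
  define K where "K = 2 * A * 4 powr (b + 1)"
  have "K \<ge> 0" using \<open>A \<ge> 0\<close> by (simp add: K_def)
  have half: "cmod (d \<zeta>) \<le> 2 * (A * 2 powr (b + 1))" if "cmod \<zeta> \<le> 1 / 2" for \<zeta>
  proof (rule maximum_modulus_frontier[of d "cball 0 (1/2)"])
    have "d holomorphic_on cball 0 (1 / 2)"
    proof -
      have "(\<lambda>\<zeta>. u (\<zeta> *s z)) holomorphic_on ball 0 1"
        unfolding holomorphic_on_open[OF open_ball]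
        using deriv by (metis dist_0_norm less_imp_le mem_ball)
      then have "deriv (\<lambda>\<zeta>. u (\<zeta> *s z)) holomorphic_on ball 0 1"
        by (rule holomorphic_deriv) simp
      then have "d holomorphic_on ball 0 1"
        by (rule holomorphic_transform) (auto intro!: DERIV_imp_deriv deriv)
      then show ?thesis by (rule holomorphic_on_subset) auto
    qed
    then show "d holomorphic_on interior (cball 0 (1/2))" "continuous_on (closure (cball 0 (1/2))) d"
      by (auto intro: holomorphic_on_subset holomorphic_on_imp_continuous_on)
    fix \<xi> :: complex assume "\<xi> \<in> frontier (cball 0 (1/2))"
    then have \<xi>: "cmod \<xi> = 1 / 2" by simp
    have "(1 - (cmod \<xi>)\<^sup>2 * r) powr (- (b + 1)) \<le> (1 / 2) powr (- (b + 1))"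
      using \<open>b > 0\<close> r by (intro powr_mono2') (auto simp: \<xi> power2_eq_square)
    then have "A * (1 - (cmod \<xi>)\<^sup>2 * r) powr (- (b + 1)) \<le> A * (1 / 2) powr (- (b + 1))"
      using \<open>A \<ge> 0\<close> by (rule mult_left_mono)
    also have "(1 / 2) powr (- (b + 1)) = (2::real) powr (b + 1)"
      by (simp only: powr_divide powr_minus powr_one_eq_one) simp
    finally show "cmod (d \<xi>) \<le> 2 * (A * 2 powr (b + 1))"
      using d_bound[of \<xi>] \<xi> by simp
  qed (use that in auto)
  have d_le: "cmod (d (of_real t)) \<le> K * (2 - r - t) powr (- (b + 1))" if t: "0 < t" "t < 1" for t
  proof (cases "t \<le> 1 / 2")
    case True
    have "2 powr (- (b + 1)) \<le> (2 - r - t) powr (- (b + 1))"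
      using \<open>b > 0\<close> r t by (intro powr_mono2') auto
    then have "K * 2 powr (- (b + 1)) \<le> K * (2 - r - t) powr (- (b + 1))"
      using \<open>K \<ge> 0\<close> by (rule mult_left_mono)
    moreover have "K * 2 powr (- (b + 1)) = 2 * (A * 2 powr (b + 1))"
    proof -
      have "(4::real) powr (b + 1) = 2 powr (b + 1) * 2 powr (b + 1)"
        by (simp flip: powr_mult)
      moreover have "(2::real) powr (b + 1) * 2 powr (- b - 1) = 1"
        by (simp flip: powr_add)
      ultimately show ?thesis by (simp add: K_def)
    qed
    ultimately show ?thesis using half[of "of_real t"] True t by simp
  next
    case False
    have "t * r \<le> r" "t * r \<le> t" "t * (t * r) \<le> t * r"
      using r t by (simp_all add: mult_left_le mult_left_le_one_le)
    then have "t\<^sup>2 * r \<le> r" "t\<^sup>2 * r \<le> t" by (simp_all add: power2_eq_square mult.assoc)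
    then have "(2 - r - t) / 2 \<le> 1 - t\<^sup>2 * r" by simp
    then have "(1 - t\<^sup>2 * r) powr (- (b + 1)) \<le> ((2 - r - t) / 2) powr (- (b + 1))"
      using \<open>b > 0\<close> r t by (intro powr_mono2') auto
    also have "\<dots> = 2 powr (b + 1) * (2 - r - t) powr (- (b + 1))"
      unfolding powr_divide powr_minus[of "2::real" "b + 1"] by (simp add: divide_inverse)
    also have "\<dots> \<le> 4 powr (b + 1) * (2 - r - t) powr (- (b + 1))"
      using \<open>b > 0\<close> by (intro mult_right_mono powr_mono2) auto
    finally have le: "A * (1 - t\<^sup>2 * r) powr (- (b + 1)) \<le> A * (4 powr (b + 1) * (2 - r - t) powr (- (b + 1)))"
      using \<open>A \<ge> 0\<close> by (rule mult_left_mono)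
    have "1 / 2 * cmod (d t) \<le> t * cmod (d t)"
      using False by (intro mult_right_mono) auto
    also have "\<dots> \<le> A * (1 - t\<^sup>2 * r) powr (- (b + 1))"
      using d_bound[of "of_real t"] t by simp
    also note le
    finally show ?thesis by (simp add: K_def)
  qed
  define \<phi> where "\<phi> t = K / b * (2 - r - t) powr (- b)" for t
  have "cmod (u (of_real 1 *s z) - u (of_real 0 *s z)) \<le> \<phi> 1 - \<phi> 0"
  proof (rule differentiable_bound_general[where f = "\<lambda>t. u (of_real t *s z)" and \<phi> = \<phi>
        and f' = "\<lambda>t. d (of_real t)" and \<phi>' = "\<lambda>t. K * (2 - r - t) powr (- (b + 1))"])
    show "continuous_on {0..1} (\<lambda>t. u (of_real t *s z))"
      by (rule continuous_on_compose2[OF cn_holomorphic_on_imp_continuous_on[OF hol]])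
         (use inball in \<open>auto intro!: continuous_intros\<close>)
    show "continuous_on {0..1} \<phi>"
      unfolding \<phi>_def using r by (intro continuous_intros) auto
    fix t :: real assume t: "0 < t" "t < 1"
    show "((\<lambda>t. u (of_real t *s z)) has_vector_derivative d (of_real t)) (at t)"
      using has_vector_derivative_real_field[OF deriv[of "of_real t"]] t by simp
    have "((\<lambda>t. (2 - r - t) powr (- b)) has_real_derivative - b * (2 - r - t) powr (- b - 1) * (- 1)) (at t)"
      by (rule DERIV_chain2[OF has_real_derivative_powr]) (use r t in \<open>auto intro!: derivative_eq_intros\<close>)
    from DERIV_cmult[OF this, of "K / b"]
    have "(\<phi> has_real_derivative K * (2 - r - t) powr (- b - 1)) (at t)"
      using \<open>b > 0\<close> by (simp add: \<phi>_def[abs_def])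
    then show "(\<phi> has_vector_derivative K * (2 - r - t) powr (- (b + 1))) (at t)"
      by (simp add: has_real_derivative_iff_has_vector_derivative)
    show "cmod (d (of_real t)) \<le> K * (2 - r - t) powr (- (b + 1))" by (rule d_le[OF t])
  qed simp
  also have "\<dots> \<le> \<phi> 1" using \<open>K \<ge> 0\<close> \<open>b > 0\<close> by (simp add: \<phi>_def)
  finally have "cmod (u z - u 0) \<le> \<phi> 1" by simp
  moreover have "\<phi> 1 = 2 * 4 powr (b + 1) / b * A * (1 - (norm z)\<^sup>2) powr (- b)"
    by (simp add: \<phi>_def K_def r_def)
  ultimately show ?thesis using norm_triangle_sub[of "u z" "u 0"] by linarith
qed

text \<open>
  The constants of integration \<open>R\<^sup>k f(0)\<close> vanish for \<open>k \<ge> 1\<close>.  Every exponent \<open>b + k\<close> met on the way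
  is positive because \<open>b\<close> is, so no logarithm appears.
\<close>

lemma radial_growth_iterate:
  fixes b :: real
  assumes "b > 0"
  shows "\<exists>C\<ge>0. \<forall>(f :: complex ^ 'n \<Rightarrow> complex) A. cn_holomorphic_on f (ball 0 1) \<longrightarrow> A \<ge> 0 \<longrightarrow>
      (\<forall>z. norm z < 1 \<longrightarrow> cmod ((radial_deriv ^^ N) f z) \<le> A * (1 - (norm z)\<^sup>2) powr (- (b + real N))) \<longrightarrow>
      (\<forall>z. norm z < 1 \<longrightarrow> cmod (f z) \<le> cmod (f 0) + C * A * (1 - (norm z)\<^sup>2) powr (- b))"
proof (induction N)
  case 0
  show ?case by (rule exI[of _ 1]) (auto intro: add_increasing)
next
  case (Suc N)
  then obtain C where C: "C \<ge> 0" and step: "\<And>(f :: complex ^ 'n \<Rightarrow> complex) A z.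
      cn_holomorphic_on f (ball 0 1) \<Longrightarrow> A \<ge> 0 \<Longrightarrow>
      (\<And>z. norm z < 1 \<Longrightarrow> cmod ((radial_deriv ^^ N) f z) \<le> A * (1 - (norm z)\<^sup>2) powr (- (b + real N))) \<Longrightarrow>
      norm z < 1 \<Longrightarrow> cmod (f z) \<le> cmod (f 0) + C * A * (1 - (norm z)\<^sup>2) powr (- b)"
    by blast
  define L where "L = 2 * 4 powr (b + real N + 1) / (b + real N)"
  have L: "L \<ge> 0" using assms by (simp add: L_def)
  define C' where "C' = (if N = 0 then L else C * L)"
  have "cmod (f z) \<le> cmod (f 0) + C' * A * (1 - (norm z)\<^sup>2) powr (- b)"
    if f: "cn_holomorphic_on f (ball 0 1)" and A: "A \<ge> 0" and z: "norm z < 1"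
      and bd: "\<And>z. norm z < 1 \<Longrightarrow>
        cmod ((radial_deriv ^^ Suc N) f z) \<le> A * (1 - (norm z)\<^sup>2) powr (- (b + real (Suc N)))"
    for f :: "complex ^ 'n \<Rightarrow> complex" and A z
  proof -
    let ?u = "(radial_deriv ^^ N) f"
    have u: "cmod (?u z) \<le> cmod (?u 0) + L * A * (1 - (norm z)\<^sup>2) powr (- (b + real N))"
      if "norm z < 1" for z
      unfolding L_def
    proof (rule radial_growth_integration)
      show "cn_holomorphic_on ?u (ball 0 1)"
        by (rule cn_holomorphic_on_radial_deriv_iterate[OF f open_ball])
      show "cmod (radial_deriv ?u z) \<le> A * (1 - (norm z)\<^sup>2) powr (- (b + real N + 1))"
        if "norm z < 1" for z
        using bd[OF that] by (simp add: add_ac)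
    qed (use assms A that in auto)
    show ?thesis
    proof (cases N)
      case 0
      then show ?thesis using u[OF z] by (simp add: C'_def)
    next
      case (Suc M)
      then have "?u 0 = 0" by (simp add: radial_deriv_0)
      then have "cmod (f z) \<le> cmod (f 0) + C * (L * A) * (1 - (norm z)\<^sup>2) powr (- b)"
        using u L A by (intro step f z) auto
      then show ?thesis using Suc by (simp add: C'_def mult.assoc)
    qed
  qed
  moreover have "C' \<ge> 0" using C L by (simp add: C'_def)
  ultimately show ?case by blast
qed

section \<open>Total mass of the weighted volume\<close>

text \<open>
  By Bernoulli, \<open>1 - r\<^sup>m \<le> m (1 - r)\<close>.
\<close>

lemma emeasure_shell_le:
  fixes r :: real
  assumes "0 \<le> r" "r \<le> 1"
  shows "emeasure lborel (ball (0::'a::euclidean_space) 1 - ball 0 r)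
    \<le> ennreal (unit_ball_vol (DIM('a)) * real DIM('a) * (1 - r))"
proof -
  let ?\<omega> = "unit_ball_vol (real DIM('a))"
  have "emeasure lborel (ball (0::'a) 1 - ball 0 r)
      = emeasure lborel (ball (0::'a) 1) - emeasure lborel (ball (0::'a) r)"
    using assms by (intro emeasure_Diff) (auto simp: emeasure_ball)
  also have "\<dots> = ennreal (?\<omega> * (1 - r ^ DIM('a)))"
    using assms by (simp add: emeasure_ball ennreal_minus algebra_simps)
  also have "\<dots> \<le> ennreal (?\<omega> * real DIM('a) * (1 - r))"
  proof (rule ennreal_leI)
    have "1 + real DIM('a) * (r - 1) \<le> (1 + (r - 1)) ^ DIM('a)"
      using assms by (intro Bernoulli_inequality) auto
    then have "1 - r ^ DIM('a) \<le> real DIM('a) * (1 - r)" by (simp add: algebra_simps)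
    then show "?\<omega> * (1 - r ^ DIM('a)) \<le> ?\<omega> * real DIM('a) * (1 - r)"
      by (simp add: mult.assoc mult_left_mono less_imp_le)
  qed
  finally show ?thesis .
qed

text \<open>
  Dyadic shells: where \<open>1 - |z|\<close> lies between \<open>2\<^bsup>-j-1\<^esup>\<close> and \<open>2\<^bsup>-j\<^esup>\<close>, the weight is
  \<open>O(2\<^bsup>-j\<alpha>\<^esup>)\<close> if \<open>\<alpha> < 0\<close>, and the shell has volume \<open>O(2\<^bsup>-j\<^esup>)\<close>, so the shells contribute a
  geometric series of ratio \<open>2\<^bsup>-\<alpha>-1\<^esup> < 1\<close>.  If \<open>\<alpha> \<ge> 0\<close>, the weight is at most \<open>1\<close>.
\<close>

lemma ball_weight_integral_finite:
  assumes "\<alpha> > -1"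
  shows "(\<integral>\<^sup>+z. ennreal ((1 - (norm z)\<^sup>2) powr \<alpha>) * indicator (ball (0::'a::euclidean_space) 1) z \<partial>lborel) < \<infinity>"
proof -
  define a where "a j = (1::real) - (1/2) ^ j" for j
  define A where "A j = ball (0::'a) 1 - ball 0 (a j)" for j
  let ?w = "unit_ball_vol (real DIM('a)) * real DIM('a)"
  \<comment> \<open>Below, the series with coefficients \<open>c\<close> dominates if \<open>\<alpha> < 0\<close>, the indicator function if \<open>\<alpha> \<ge> 0\<close>.\<close>
  define c where "c = 1 + 2 powr (- \<alpha>)"
  have le: "ennreal ((1 - (norm z)\<^sup>2) powr \<alpha>) * indicator (ball (0::'a) 1) z
      \<le> (\<Sum>j. ennreal (c * (2 powr (- \<alpha>)) ^ j) * indicator (A j) z) + indicator (ball 0 1) z" for z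
  proof (cases "z \<in> ball 0 1")
    case True
    let ?x = "1 - norm z"
    have x: "0 < ?x" "?x \<le> 1" using True by auto
    have "\<exists>j. (1/2::real) ^ j < ?x" using x real_arch_pow_inv[of ?x "1/2"] by auto
    \<comment> \<open>The shell of \<open>z\<close> is found from the first power of \<open>1/2\<close> that falls below \<open>1 - |z|\<close>.\<close>
    define J where "J = (LEAST j. (1/2::real) ^ j < ?x)"
    have J: "(1/2::real) ^ J < ?x"
      unfolding J_def by (rule LeastI_ex) fact
    have "J \<noteq> 0" using J x by (intro notI) auto
    then obtain j where j: "J = Suc j" by (cases J) auto
    have j2: "?x \<le> (1/2) ^ j"
      using not_less_Least[of j "\<lambda>j. (1/2::real) ^ j < ?x"] j unfolding J_def by auto
    have zA: "z \<in> A j" using True j2 by (auto simp: A_def a_def)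
    have y: "?x \<le> 1 - (norm z)\<^sup>2" "1 - (norm z)\<^sup>2 \<le> 1"
      using x by (auto simp: power2_eq_square mult_left_le)
    have "(1 - (norm z)\<^sup>2) powr \<alpha> \<le> c * (2 powr (- \<alpha>)) ^ j + 1"
    proof (cases "\<alpha> \<ge> 0")
      case True
      have "(1 - (norm z)\<^sup>2) powr \<alpha> \<le> 1 powr \<alpha>" using x y True by (intro powr_mono2) auto
      also have "\<dots> \<le> c * (2 powr (- \<alpha>)) ^ j + 1" by (simp add: c_def)
      finally show ?thesis .
    next
      case False
      have "(1 - (norm z)\<^sup>2) powr \<alpha> \<le> ((1/2) ^ J) powr \<alpha>"
        using J x y False by (intro powr_mono2') auto
      also have "\<dots> = (2 powr (- \<alpha>)) ^ J"
        by (simp add: powr_realpow[symmetric] powr_powr powr_minus powr_divide powr_one_eq_one field_simps)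
      also have "\<dots> \<le> c * (2 powr (- \<alpha>)) ^ j + 1"
        by (simp add: j c_def algebra_simps)
      finally show ?thesis .
    qed
    then have "ennreal ((1 - (norm z)\<^sup>2) powr \<alpha>) \<le> ennreal (c * (2 powr (- \<alpha>)) ^ j) + 1"
      by (simp add: c_def ennreal_plus[symmetric] ennreal_1[symmetric] del: ennreal_plus ennreal_1)
    also have "ennreal (c * (2 powr (- \<alpha>)) ^ j) \<le> (\<Sum>j. ennreal (c * (2 powr (- \<alpha>)) ^ j) * indicator (A j) z)"
      using sum_le_suminf[of "\<lambda>j. ennreal (c * (2 powr (- \<alpha>)) ^ j) * indicator (A j) z" "{j}"] zA by simp
    finally show ?thesis using True by simp
  qed simp
  have [measurable]: "A j \<in> sets borel" for j by (simp add: A_def)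
  have "(\<integral>\<^sup>+z. ennreal ((1 - (norm z)\<^sup>2) powr \<alpha>) * indicator (ball (0::'a) 1) z \<partial>lborel)
      \<le> (\<integral>\<^sup>+z. (\<Sum>j. ennreal (c * (2 powr (- \<alpha>)) ^ j) * indicator (A j) z) + indicator (ball 0 1) z \<partial>lborel)"
    by (intro nn_integral_mono le)
  also have "\<dots> = (\<Sum>j. ennreal (c * (2 powr (- \<alpha>)) ^ j) * emeasure lborel (A j)) + emeasure lborel (ball (0::'a) 1)"
    by (subst nn_integral_add) (auto simp: nn_integral_suminf nn_integral_cmult_indicator intro!: borel_measurable_indicator)
  also have "(\<Sum>j. ennreal (c * (2 powr (- \<alpha>)) ^ j) * emeasure lborel (A j))
      \<le> (\<Sum>j. ennreal (c * ?w * ((2 powr (- \<alpha>)) / 2) ^ j))"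
  proof (intro suminf_le summableI)
    fix j
    have "emeasure lborel (A j) \<le> ennreal (?w * (1/2) ^ j)"
      using emeasure_shell_le[of "a j", where 'a='a] by (simp add: A_def a_def power_le_one)
    then have "ennreal (c * (2 powr (- \<alpha>)) ^ j) * emeasure lborel (A j)
        \<le> ennreal (c * (2 powr (- \<alpha>)) ^ j) * ennreal (?w * (1/2) ^ j)"
      by (intro mult_left_mono) auto
    also have "\<dots> = ennreal (c * ?w * ((2 powr (- \<alpha>)) / 2) ^ j)"
      by (subst ennreal_mult[symmetric]) (auto simp: c_def power_divide intro!: mult_nonneg_nonneg arg_cong[of _ _ ennreal])
    finally show "ennreal (c * (2 powr (- \<alpha>)) ^ j) * emeasure lborel (A j)
        \<le> ennreal (c * ?w * ((2 powr (- \<alpha>)) / 2) ^ j)" .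
  qed
  also have "\<dots> < \<infinity>"
  proof -
    have "(2 powr (- \<alpha>)) / 2 = 2 powr (- \<alpha> - 1)" by (simp add: powr_diff)
    also have "\<dots> < 2 powr 0" using assms by (intro powr_less_mono) auto
    finally have "norm ((2 powr (- \<alpha>)) / 2) < 1" by simp
    then have "summable (\<lambda>j. c * ?w * ((2 powr (- \<alpha>)) / 2) ^ j)"
      by (intro summable_mult summable_geometric)
    then show ?thesis
      by (subst suminf_ennreal2) (auto simp: c_def less_imp_le intro!: mult_nonneg_nonneg)
  qed
  finally show ?thesis
    by (simp add: emeasure_ball)
qed

text \<open>
  The normalization only costs a constant, but this rests on the total mass being finite: dividing by
  an infinite mass would give the zero measure.
\<close>

lemma nn_integral_weighted_vol_ge:
  fixes \<alpha> :: real
  obtains \<kappa> where "\<kappa> > 0"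
    and "\<And>F :: complex ^ 'n \<Rightarrow> ennreal. F \<in> borel_measurable (restrict_space lborel (ball 0 1)) \<Longrightarrow>
      ennreal \<kappa> * (\<integral>\<^sup>+z. ennreal ((1 - (norm z)\<^sup>2) powr \<alpha>) * F z * indicator (ball 0 1) z \<partial>lborel)
      \<le> (\<integral>\<^sup>+z. F z \<partial>weighted_vol \<alpha>)"
proof -
  let ?B = "ball (0 :: complex ^ 'n) 1"
  let ?w = "\<lambda>z :: complex ^ 'n. ennreal ((1 - (norm z)\<^sup>2) powr \<alpha>)"
  let ?U = "unnormalized_vol \<alpha> :: (complex ^ 'n) measure"
  have [measurable]: "(\<lambda>z :: complex ^ 'n. (1 - (norm z)\<^sup>2) powr \<alpha>) \<in> borel_measurable (restrict_space lborel ?B)"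
    by (intro measurable_restrict_space1) measurable
  have U: "(\<integral>\<^sup>+z. F z \<partial>?U) = (\<integral>\<^sup>+z. ?w z * F z * indicator ?B z \<partial>lborel)"
    if [measurable]: "F \<in> borel_measurable (restrict_space lborel ?B)" for F
    unfolding unnormalized_vol_def
    by (subst nn_integral_density, measurable) (simp add: nn_integral_restrict_space)
  show thesis
  proof (cases "\<alpha> > -1")
    case True
    define \<mu> where "\<mu> = emeasure ?U ?B"
    have "\<mu> = (\<integral>\<^sup>+z. ?w z * indicator ?B z \<partial>lborel)"
    proof -
      have "\<mu> = (\<integral>\<^sup>+z. ?w z * indicator ?B z \<partial>restrict_space lborel ?B)"
        unfolding \<mu>_def unnormalized_vol_def
        by (rule emeasure_density) (auto simp: sets_restrict_space_iff)
      also have "\<dots> = (\<integral>\<^sup>+z. ?w z * indicator ?B z * indicator ?B z \<partial>lborel)"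
        by (rule nn_integral_restrict_space) simp
      finally show ?thesis by (simp add: mult.assoc flip: indicator_inter_arith)
    qed
    with ball_weight_integral_finite[OF True, where 'a="complex ^ 'n"] have "\<mu> < \<infinity>" by simp
    then obtain m where m: "m \<ge> 0" "\<mu> = ennreal m" by (cases \<mu>) auto
    have le: "ennreal (1 / (m + 1)) \<le> inverse \<mu>"
    proof (cases "m = 0")
      case False
      then show ?thesis
        using m by (simp add: inverse_ennreal ennreal_leI field_simps)
    qed (simp add: m)
    show thesis
    proof (rule that[of "1 / (m + 1)"])
      fix F :: "complex ^ 'n \<Rightarrow> ennreal"
      assume F: "F \<in> borel_measurable (restrict_space lborel ?B)"
      then have FU: "F \<in> borel_measurable ?U"
        by (simp add: unnormalized_vol_def)
      have "(\<integral>\<^sup>+z. F z \<partial>weighted_vol \<alpha>) = inverse \<mu> * (\<integral>\<^sup>+z. F z \<partial>?U)"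
        unfolding weighted_vol_def \<mu>_def using True FU by (simp add: nn_integral_scale_measure)
      then show "ennreal (1 / (m + 1)) * (\<integral>\<^sup>+z. ?w z * F z * indicator ?B z \<partial>lborel)
          \<le> (\<integral>\<^sup>+z. F z \<partial>weighted_vol \<alpha>)"
        using le by (simp add: U[OF F] mult_right_mono)
    qed (use m in auto)
  next
    case False
    then show thesis using that[of 1] by (simp add: weighted_vol_def U)
  qed
qed


section \<open>Growth of functions in the Bergman space\<close>

theorem theorem20:
  fixes p \<alpha> :: real
  assumes "p > 0" and "real CARD('n::finite) + 1 + \<alpha> > 0"
  shows "\<exists>C::real. C > 0 \<and>
    (\<forall>f \<in> (bergman_space p \<alpha> :: (complex ^ 'n \<Rightarrow> complex) set). \<forall>z \<in> ball 0 1.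
      ennreal (cmod (f z)) \<le>
        ennreal C * bergman_norm p \<alpha> f /
        ennreal ((1 - (norm z)\<^sup>2) powr ((real CARD('n) + 1 + \<alpha>) / p)))"
proof -
  define N where "N = bergman_order p \<alpha>"
  define \<gamma> where "\<gamma> = \<alpha> + p * real N"
  define b where "b = (real CARD('n) + 1 + \<alpha>) / p"
  have b: "b > 0" using assms by (simp add: b_def)
  \<comment> \<open>The weight \<open>(1 - |z|\<^sup>2)\<^bsup>pN\<^esup>\<close> in the norm costs exactly the growth that \<open>N\<close> radial integrations recover.\<close>
  have bN: "(real CARD('n) + 1 + \<gamma>) / p = b + real N"
    using \<open>p > 0\<close> by (simp add: b_def \<gamma>_def field_simps)
  obtain C1 where C1: "C1 > 0" and point:
    "\<And>(g :: complex ^ 'n \<Rightarrow> complex) z. cn_holomorphic_on g (ball 0 1) \<Longrightarrow> norm z < 1 \<Longrightarrow>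
      ennreal (cmod (g z) powr p * (1 - (norm z)\<^sup>2) powr (real CARD('n) + 1 + \<gamma>)) \<le>
      ennreal C1 * (\<integral>\<^sup>+w. ennreal ((1 - (norm w)\<^sup>2) powr \<gamma> * cmod (g w) powr p) * indicator (ball 0 1) w \<partial>lborel)"
    by (rule weighted_pointwise_bound[OF \<open>p > 0\<close>, where \<gamma> = \<gamma>]) (rule that; assumption)
  obtain \<kappa> where \<kappa>: "\<kappa> > 0" and weight:
    "\<And>F :: complex ^ 'n \<Rightarrow> ennreal. F \<in> borel_measurable (restrict_space lborel (ball 0 1)) \<Longrightarrow>
      ennreal \<kappa> * (\<integral>\<^sup>+z. ennreal ((1 - (norm z)\<^sup>2) powr \<alpha>) * F z * indicator (ball 0 1) z \<partial>lborel)
      \<le> (\<integral>\<^sup>+z. F z \<partial>weighted_vol \<alpha>)"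
    by (rule nn_integral_weighted_vol_ge[where \<alpha> = \<alpha>]) (rule that; assumption)
  obtain C3 where C3: "C3 \<ge> 0" and integrate:
    "\<forall>(f :: complex ^ 'n \<Rightarrow> complex) A. cn_holomorphic_on f (ball 0 1) \<longrightarrow> A \<ge> 0 \<longrightarrow>
      (\<forall>z. norm z < 1 \<longrightarrow> cmod ((radial_deriv ^^ N) f z) \<le> A * (1 - (norm z)\<^sup>2) powr (- (b + real N))) \<longrightarrow>
      (\<forall>z. norm z < 1 \<longrightarrow> cmod (f z) \<le> cmod (f 0) + C3 * A * (1 - (norm z)\<^sup>2) powr (- b))"
    using radial_growth_iterate[OF b, of N] by (elim exE conjE)
  \<comment> \<open>The summand \<open>1\<close> absorbs \<open>|f(0)|\<close>, because \<open>(1 - |z|\<^sup>2)\<^bsup>-b\<^esup> \<ge> 1\<close>.\<close>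
  define C where "C = 1 + C3 * (C1 / \<kappa>) powr (1 / p)"
  have C: "C > 0" unfolding C_def using C3 by (simp add: add_pos_nonneg)
  have main: "ennreal (cmod (f z)) \<le> ennreal C * bergman_norm p \<alpha> f / ennreal ((1 - (norm z)\<^sup>2) powr b)"
    if "f \<in> bergman_space p \<alpha>" and z: "z \<in> ball 0 1" for f :: "complex ^ 'n \<Rightarrow> complex" and z
  proof -
    have f: "cn_holomorphic_on f (ball 0 1)" using that(1) by (simp add: bergman_space_def)
    define g where "g = (radial_deriv ^^ N) f"
    have g: "cn_holomorphic_on g (ball 0 1)"
      unfolding g_def by (rule cn_holomorphic_on_radial_deriv_iterate[OF f open_ball])
    define J where "J = (\<integral>\<^sup>+z. ennreal ((1 - (norm z)\<^sup>2) powr (p * real N) * cmod (g z) powr p) \<partial>weighted_vol \<alpha>)"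
    have norm_eq: "bergman_norm p \<alpha> f = ennreal (cmod (f 0)) + ennreal_powr J (1 / p)"
      by (simp add: bergman_norm_def J_def g_def N_def Let_def)
    have \<delta>: "0 < 1 - (norm z)\<^sup>2" "1 - (norm z)\<^sup>2 \<le> 1" if "norm z < 1" for z :: "complex ^ 'n"
      using that by (auto simp: abs_square_less_1)
    show ?thesis
    proof (cases "J = \<infinity>")
      case True
      then have "bergman_norm p \<alpha> f = \<infinity>" by (simp add: norm_eq ennreal_powr_def)
      then show ?thesis using C by (simp add: ennreal_mult_top ennreal_top_divide)
    next
      case False
      then obtain j where j: "j \<ge> 0" "J = ennreal j" by (cases J) auto
      have "g \<in> borel_measurable (restrict_space borel (ball 0 1))"
        using cn_holomorphic_on_imp_continuous_on[OF g]
        by (rule borel_measurable_continuous_on_restrict)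
      then have [measurable]: "g \<in> borel_measurable (restrict_space lborel (ball 0 1))"
        by (simp cong: measurable_cong_sets sets_restrict_space_cong)
      have [measurable]: "(\<lambda>z :: complex ^ 'n. (1 - (norm z)\<^sup>2) powr (p * real N))
          \<in> borel_measurable (restrict_space lborel (ball 0 1))"
        by (intro measurable_restrict_space1) measurable
      let ?I = "\<integral>\<^sup>+w. ennreal ((1 - (norm w)\<^sup>2) powr \<gamma> * cmod (g w) powr p) * indicator (ball 0 1) w \<partial>lborel"
      have "ennreal \<kappa> * ?I = ennreal \<kappa> * (\<integral>\<^sup>+z. ennreal ((1 - (norm z)\<^sup>2) powr \<alpha>) *
          ennreal ((1 - (norm z)\<^sup>2) powr (p * real N) * cmod (g z) powr p) * indicator (ball 0 1) z \<partial>lborel)"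
        by (simp add: \<gamma>_def powr_add mult.assoc flip: ennreal_mult)
      also have "\<dots> \<le> J"
        unfolding J_def by (rule weight) measurable
      finally have "ennreal (C1 / \<kappa>) * (ennreal \<kappa> * ?I) \<le> ennreal (C1 / \<kappa>) * J"
        by (rule mult_left_mono) simp
      then have I_le: "ennreal C1 * ?I \<le> ennreal (C1 / \<kappa> * j)"
        using \<kappa> C1 j by (simp add: ennreal_mult[symmetric] mult.assoc[symmetric])
      define A where "A = (C1 / \<kappa> * j) powr (1 / p)"
      have "cmod (g z) \<le> A * (1 - (norm z)\<^sup>2) powr (- (b + real N))" if z: "norm z < 1" for z
      proof -
        let ?q = "real CARD('n) + 1 + \<gamma>"
        have "cmod (g z) powr p * (1 - (norm z)\<^sup>2) powr ?q \<le> C1 / \<kappa> * j"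
          using order_trans[OF point[OF g z] I_le] C1 \<kappa> j by (simp add: ennreal_le_iff)
        then have "(cmod (g z) powr p * (1 - (norm z)\<^sup>2) powr ?q) powr (1 / p) \<le> A"
          unfolding A_def using \<open>p > 0\<close> by (intro powr_mono2) auto
        moreover have "(cmod (g z) powr p * (1 - (norm z)\<^sup>2) powr ?q) powr (1 / p)
            = cmod (g z) * (1 - (norm z)\<^sup>2) powr (b + real N)"
          using \<open>p > 0\<close> by (simp add: powr_mult powr_powr flip: bN)
        ultimately have le: "cmod (g z) * (1 - (norm z)\<^sup>2) powr (b + real N) \<le> A" by simp
        have "(1 - (norm z)\<^sup>2) powr (b + real N) > 0" using \<delta>[OF z] by simp
        with le show ?thesis
          unfolding powr_minus_divide by (simp add: pos_le_divide_eq)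
      qed
      then have "cmod (f z) \<le> cmod (f 0) + C3 * A * (1 - (norm z)\<^sup>2) powr (- b)"
        using z by (intro integrate[rule_format] f) (auto simp: A_def g_def)
      also have "\<dots> \<le> C * (cmod (f 0) + j powr (1 / p)) * (1 - (norm z)\<^sup>2) powr (- b)"
      proof -
        have one: "1 \<le> (1 - (norm z)\<^sup>2) powr (- b)"
          using \<delta>[of z] z b powr_mono2'[of "- b" "1 - (norm z)\<^sup>2" 1] by simp
        have A: "A = (C1 / \<kappa>) powr (1 / p) * j powr (1 / p)"
          by (simp only: A_def powr_mult)
        have "cmod (f 0) * 1 \<le> cmod (f 0) * (1 - (norm z)\<^sup>2) powr (- b)"
          using one by (intro mult_left_mono) auto
        moreover have "cmod (f 0) + C3 * A \<le> C * (cmod (f 0) + j powr (1 / p))"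
          using C3 by (simp add: C_def A algebra_simps)
        then have "(cmod (f 0) + C3 * A) * (1 - (norm z)\<^sup>2) powr (- b)
            \<le> C * (cmod (f 0) + j powr (1 / p)) * (1 - (norm z)\<^sup>2) powr (- b)"
          by (rule mult_right_mono) simp
        ultimately show ?thesis by (simp add: distrib_right)
      qed
      also have "\<dots> = C * (cmod (f 0) + j powr (1 / p)) / (1 - (norm z)\<^sup>2) powr b"
        by (simp add: powr_minus_divide)
      finally have "ennreal (cmod (f z)) \<le> ennreal (C * (cmod (f 0) + j powr (1 / p)) / (1 - (norm z)\<^sup>2) powr b)"
        by (rule ennreal_leI)
      also have "\<dots> = ennreal C * bergman_norm p \<alpha> f / ennreal ((1 - (norm z)\<^sup>2) powr b)"
        using C \<delta>[of z] z j
        by (simp add: norm_eq ennreal_powr_def divide_ennreal[symmetric] ennreal_mult ennreal_plus)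
      finally show ?thesis .
    qed
  qed
  show ?thesis
    using C main by (intro exI[of _ C]) (simp add: b_def)
qed

end
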